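(* Let $\alpha\in\mathbb{C}$ with $\alpha\neq0$, let $a>0$ be real and $b\in\mathbb{C}$. For every real $x>0$ and every real $c>0$ with $c>\frac{\max\{1-\Re(b),\,1-\Re(b-\alpha)\}}{a}$, $$\frac{1}{2\pi i}\int_{c-i\infty}^{c+i\infty}\Gamma(s)\zeta(as+b)\zeta(as+b-\alpha)\frac{ds}{x^{s}}=\sum_{n=1}^{\infty}\frac{\sigma_{\alpha}(n)}{n^{b}}e^{-n^{a}x}.$$ Furthermore, the following asymptotic expansions hold as $x\to0^{+}$. (i) If $an\neq b-1$ and $an\neq b-1-\alpha$ for all integers $n\ge0$, then $$\sum_{n=1}^{\infty}\frac{\sigma_{\alpha}(n)}{n^{b}}e^{-n^{a}x}\sim\sum_{n=0}^{\infty}\frac{(-x)^{n}}{n!}\zeta(b-an)\zeta(b-an-\alpha)+\frac{x^{(b-1)/a}}{a}\Gamma\left(\frac{1-b}{a}\right)\zeta(1-\alpha)+\frac{x^{(b-1-\alpha)/a}}{a}\Gamma\left(\frac{1-b+\alpha}{a}\right)\zeta(1+\alpha).$$ (ii) If $am=b-1$ for some integer $m\ge0$ and $an\neq b-1-\alpha$ for all integers $n\ge0$, then $$\sum_{n=1}^{\infty}\frac{\sigma_{\alpha}(n)}{n^{b}}e^{-n^{a}x}\sim\frac{(-x)^{m}\left(a\zeta'(1-\alpha)+\zeta(1-\alpha)(\gamma a+\psi(m+1)-\log x)\right)}{a\,m!}+\frac{x^{m-\alpha/a}}{a}\Gamma\left(\frac{\alpha-ma}{a}\right)\zeta(1+\alpha)+\sum_{\substack{n\ge0\\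 n\neq m}}\frac{(-x)^{n}}{n!}\zeta(1-a(n-m))\,\zeta(1-\alpha-a(n-m)).$$ (iii) If $an\neq b-1$ for all integers $n\ge0$ and $am=b-1-\alpha$ for some integer $m\ge0$, then $$\sum_{n=1}^{\infty}\frac{\sigma_{\alpha}(n)}{n^{b}}e^{-n^{a}x}\sim\frac{x^{m+\alpha/a}}{a}\Gamma\left(-\frac{am+\alpha}{a}\right)\zeta(1-\alpha)+\frac{(-x)^{m}\left(a\zeta'(1+\alpha)+\zeta(1+\alpha)(\gamma a+\psi(m+1)-\log x)\right)}{a\,m!}+\sum_{\substack{n\ge0\\ n\neq m}}\frac{(-x)^{n}}{n!}\zeta(1+\alpha-a(n-m))\,\zeta(1-a(n-m)).$$ (iv) If $am=b-1$ and $\alpha=a(m-\ell)$ for some integers $m,\ell\ge0$ with $m\neq\ell$, then $$\sum_{n=1}^{\infty}\frac{\sigma_{\alpha}(n)}{n^{b}}e^{-n^{a}x}\sim\sum_{\substack{n\ge0\\ n\neq m,\ell}}\frac{(-x)^{n}}{n!}\zeta(1-a(n-m))\,\zeta(1-a(n-\ell))+\frac{(-x)^{m}\left(a\zeta'(1-a(m-\ell))+\zeta(1-a(m-\ell))(\gamma a+\psi(m+1)-\log x)\right)}{a\,m!}+\frac{(-x)^{\ell}\left(a\zeta'(1+a(m-\ell))+\zeta(1+a(m-\ell))(\gamma a+\psi(\ell+1)-\log x)\right)}{a\,\ell!}.$$ Here $\sim$ means: for every integer $N\ge0$, the left side minus the expression obtained from the right side by restricting the sum over $n$ to $n\le N$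 (all other terms being kept) is $o(x^{N})$ as $x\to0^{+}$.
   Context: $\sigma_{\alpha}(n)=\sum_{d\mid n}d^{\alpha}$, the sum being over positive divisors $d$ of $n$. $\Gamma$ is the Euler gamma function (meromorphically continued), $\psi=\Gamma'/\Gamma$ is the digamma function, $\gamma=-\psi(1)$ is Euler's constant, $\zeta$ is the meromorphic continuation of the Riemann zeta function and $\zeta'$ its derivative. Powers of positive reals use the real logarithm. *)

theory Defs
  imports "HOL-Complex_Analysis.Complex_Analysis" "HOL-Library.Landau_Symbols"
begin

definition is_zeta_continuation :: "(complex \<Rightarrow> complex) \<Rightarrow> bool" where
  "is_zeta_continuation f \<longleftrightarrow> f nicely_meromorphic_on UNIV \<and>
     (\<forall>s. Re s > 1 \<longrightarrow> f s = (\<Sum>n. 1 / of_nat (Suc n) powr s))"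

text \<open>
  Being nicely meromorphic fixes the values at removable singularities and makes the value at a
  pole 0, so the continuation is unique as a total function (see below).
\<close>

definition zeta :: "complex \<Rightarrow> complex" where
  "zeta = (THE f. is_zeta_continuation f)"

lemma is_zeta_continuation_unique:
  assumes "is_zeta_continuation f" "is_zeta_continuation g"
  shows "f = g"
proof -
  have mero: "f meromorphic_on UNIV" "g meromorphic_on UNIV"
    and lim: "\<And>z. (is_pole f z \<and> f z = 0) \<or> f \<midarrow>z\<rightarrow> f z"
             "\<And>z. (is_pole g z \<and> g z = 0) \<or> g \<midarrow>z\<rightarrow> g z"
    and eq: "\<And>s. Re s > 1 \<Longrightarrow> f s = g s"
    using assms by (auto simp: is_zeta_continuation_def nicely_meromorphic_on_def)
  define h where "h = (\<lambda>z. f z - g z)"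
  have h: "h meromorphic_on UNIV"
    unfolding h_def by (intro meromorphic_intros mero)
  have ev: "eventually (\<lambda>w. remove_sings h w = h w) (at z)" for z
    by (intro eventually_remove_sings_eq_at meromorphic_on_isolated_singularity
              meromorphic_on_subset[OF h]) auto
  have "eventually (\<lambda>w. w \<in> {s. Re s > 1}) (at 2)"
    by (intro eventually_at_in_open' open_halfspace_Re_gt) auto
  with ev[of 2] have "eventually (\<lambda>w. remove_sings h w = 0) (at 2)"
    by eventually_elim (simp add: h_def eq)
  hence freq: "frequently (\<lambda>w. remove_sings h w = 0) (at 2)"
    by (intro eventually_frequently) auto
  have h0: "remove_sings h w = 0" for w
    by (rule frequently_eq_meromorphic_imp_constant[OF freq remove_sings_nicely_meromorphic[OF h]])
       auto
  have fg: "eventually (\<lambda>w. f w = g w) (at z)" for z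
    using ev[of z] by eventually_elim (use h0 in \<open>simp add: h_def\<close>)
  show "f = g"
  proof
    fix z
    have pole: "is_pole f z \<longleftrightarrow> is_pole g z"
      by (intro is_pole_cong fg refl)
    have tends: "f \<midarrow>z\<rightarrow> c \<longleftrightarrow> g \<midarrow>z\<rightarrow> c" for c
      by (intro tendsto_cong fg)
    have no: "\<not> is_pole k z" if "k \<midarrow>z\<rightarrow> c" for k :: "complex \<Rightarrow> complex" and c
      using that not_tendsto_and_filterlim_at_infinity[of "at z" k c] by (auto simp: is_pole_def)
    show "f z = g z"
      using lim[of z] pole tends no LIM_unique by metis
  qed
qed

definition divisor_sigma :: "complex \<Rightarrow> nat \<Rightarrow> complex" where
  "divisor_sigma \<alpha> n = (\<Sum>d | d dvd n. of_nat d powr \<alpha>)"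

text \<open>The integral of \<open>f(s) ds\<close> over the upward line \<open>Re s = c\<close>, parametrised by \<open>s = c + it\<close>.\<close>

definition vertical_line_integrable :: "real \<Rightarrow> (complex \<Rightarrow> complex) \<Rightarrow> bool" where
  "vertical_line_integrable c f \<longleftrightarrow> integrable lborel (\<lambda>t. f (Complex c t))"

definition vertical_line_integral :: "real \<Rightarrow> (complex \<Rightarrow> complex) \<Rightarrow> complex" where
  "vertical_line_integral c f = \<i> * (LINT t|lborel. f (Complex c t))"

text \<open>
  \<open>f(x) \<sim> h(x) + \<Sum>\<^sub>n u\<^sub>n(x)\<close> as \<open>x \<rightarrow> 0+\<close>, with \<open>n\<close> ranging over \<open>I\<close>: for every \<open>N\<close>, truncating the
  series (only) to \<open>n \<le> N\<close> leaves an error \<open>o(x^N)\<close>.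
\<close>

definition asymp_expansion_0 ::
    "(real \<Rightarrow> complex) \<Rightarrow> (real \<Rightarrow> complex) \<Rightarrow> nat set \<Rightarrow> (nat \<Rightarrow> real \<Rightarrow> complex) \<Rightarrow> bool" where
  "asymp_expansion_0 f h I u \<longleftrightarrow>
     (\<forall>N. (\<lambda>x. f x - (h x + (\<Sum>n | n \<in> I \<and> n \<le> N. u n x)))
            \<in> o[at_right 0](\<lambda>x. of_real x ^ N))"

definition sigma_exp_term :: "complex \<Rightarrow> real \<Rightarrow> complex \<Rightarrow> real \<Rightarrow> nat \<Rightarrow> complex" where
  "sigma_exp_term \<alpha> a b x n =
     divisor_sigma \<alpha> n / of_nat n powr b * of_real (exp (- (real n powr a) * x))"

definition sigma_exp_sum :: "complex \<Rightarrow> real \<Rightarrow> complex \<Rightarrow> real \<Rightarrow> complex" where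
  "sigma_exp_sum \<alpha> a b x = (\<Sum>n. sigma_exp_term \<alpha> a b x (Suc n))"

end

theory Submission
  imports Defs "HOL-Probability.Sinc_Integral" "HOL-Real_Asymp.Real_Asymp"
begin

text \<open>
  Since \<open>\<zeta>(s) \<zeta>(s - \<alpha>)\<close> is the Dirichlet series of \<open>\<sigma>\<^sub>\<alpha>\<close>, the integral formula is termwise Mellin
  inversion of \<open>exp (- n\<^sup>a x)\<close>. For the expansions the line of integration is moved to
  \<open>Re s = - M - 1/2\<close> with \<open>M\<close> so large that both zeta poles \<open>(1 - b)/a\<close> and \<open>(1 - b + \<alpha>)/a\<close> are
  crossed: the integral left over is \<open>O(x\<^sup>M\<^sup>+\<^sup>1\<^sup>/\<^sup>2)\<close>, and the residues are the terms of the expansion.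
  The four cases differ only in which zeta poles coincide with poles \<open>- n\<close> of \<open>\<Gamma>\<close>, where a double
  pole and hence a logarithm arises. The shift is justified by the decay of \<open>\<Gamma>\<close>
  beyond all powers of \<open>Im s\<close> against the polynomial growth of \<open>\<zeta>\<close> in vertical strips.
\<close>

text \<open>The functional equation of \<zeta> does not enter: continuation and growth bound come
  out of one recursion, so every step has to deliver both, and \<open>half_plane_poly\<close>
  packages the two. Working with \<open>zeta_reg\<close>, that is (s - 1) \<zeta>(s), keeps
  everything entire; it has value 1 and derivative \<gamma> at 1. This explains the logarithmic
  terms: at a double pole the residue is the derivative of a product of regularized factors, to
  which \<open>Gamma_reg\<close> contributes \<psi>(m + 1), \<open>zeta_reg\<close> contributes
  \<gamma> a, the power x^(-s) contributes -log x, and the remaining zeta factor contributes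
  \<zeta>'. Since \<alpha> \<noteq> 0 keeps the two zeta poles apart, no triple pole can occur. The
  lines at -M - 1/2 run midway between poles of \<Gamma>. How large M must be depends on a, b and
  \<alpha>, so it may exceed the N at which the expansion is truncated; the surplus terms are
  absorbed into o(x^N).\<close>

subsection \<open>Holomorphic functions of polynomial growth on half-planes\<close>

text \<open>The constants may depend on \<open>A\<close> because the series used for the
  continuation converge ever more slowly as Re s approaches the boundary. Leaving Re s unbounded
  above lets the shifted arguments s + 1, s + 2, ... of the recursion fall under the same
  bound.\<close>

definition half_plane_poly :: "real \<Rightarrow> (complex \<Rightarrow> complex) \<Rightarrow> bool" where
  "half_plane_poly \<sigma> f \<longleftrightarrow> f holomorphic_on {s. Re s > \<sigma>} \<and>
     (\<forall>A>\<sigma>. \<exists>C K. C \<ge> 0 \<and> (\<forall>s. Re s \<ge> A \<longrightarrow> norm (f s) \<le> C * (1 + norm s) ^ K))"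

lemma half_plane_polyE:
  assumes "half_plane_poly \<sigma> f" "A > \<sigma>"
  obtains C K where "C \<ge> 0" "\<And>s. Re s \<ge> A \<Longrightarrow> norm (f s) \<le> C * (1 + norm s) ^ K"
  using assms unfolding half_plane_poly_def by metis

lemma half_plane_poly_holomorphic: "half_plane_poly \<sigma> f \<Longrightarrow> f holomorphic_on {s. Re s > \<sigma>}"
  by (simp add: half_plane_poly_def)

lemma half_plane_poly_const: "half_plane_poly \<sigma> (\<lambda>_. c)"
  unfolding half_plane_poly_def
  by (intro conjI allI impI exI[of _ "norm c"] exI[of _ 0]) auto

lemma half_plane_poly_ident: "half_plane_poly \<sigma> (\<lambda>s. s)"
  unfolding half_plane_poly_def
  by (intro conjI allI impI exI[of _ "1::real"] exI[of _ "1::nat"] holomorphic_intros) auto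

lemma half_plane_poly_mult:
  assumes "half_plane_poly \<sigma> f" "half_plane_poly \<sigma> g"
  shows "half_plane_poly \<sigma> (\<lambda>s. f s * g s)"
  unfolding half_plane_poly_def
proof (intro conjI allI impI)
  show "(\<lambda>s. f s * g s) holomorphic_on {s. Re s > \<sigma>}"
    using assms by (intro holomorphic_intros half_plane_poly_holomorphic)
  fix A assume A: "A > \<sigma>"
  obtain C K where 1: "C \<ge> 0" "\<And>s. Re s \<ge> A \<Longrightarrow> norm (f s) \<le> C * (1 + norm s) ^ K"
    using half_plane_polyE[OF assms(1) A] by blast
  obtain D L where 2: "D \<ge> 0" "\<And>s. Re s \<ge> A \<Longrightarrow> norm (g s) \<le> D * (1 + norm s) ^ L"
    using half_plane_polyE[OF assms(2) A] by blast
  have "norm (f s * g s) \<le> (C * D) * (1 + norm s) ^ (K + L)" if "Re s \<ge> A" for s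
  proof -
    have "norm (f s * g s) \<le> (C * (1 + norm s) ^ K) * (D * (1 + norm s) ^ L)"
      unfolding norm_mult using 1 2 that by (intro mult_mono) auto
    thus ?thesis by (simp add: power_add mult_ac)
  qed
  thus "\<exists>C K. C \<ge> 0 \<and> (\<forall>s. Re s \<ge> A \<longrightarrow> norm (f s * g s) \<le> C * (1 + norm s) ^ K)"
    using 1(1) 2(1) by (intro exI[of _ "C * D"] exI[of _ "K + L"]) auto
qed

lemma half_plane_poly_add:
  assumes "half_plane_poly \<sigma> f" "half_plane_poly \<sigma> g"
  shows "half_plane_poly \<sigma> (\<lambda>s. f s + g s)"
  unfolding half_plane_poly_def
proof (intro conjI allI impI)
  show "(\<lambda>s. f s + g s) holomorphic_on {s. Re s > \<sigma>}"
    using assms by (intro holomorphic_intros half_plane_poly_holomorphic)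
  fix A assume A: "A > \<sigma>"
  obtain C K where 1: "C \<ge> 0" "\<And>s. Re s \<ge> A \<Longrightarrow> norm (f s) \<le> C * (1 + norm s) ^ K"
    using half_plane_polyE[OF assms(1) A] by blast
  obtain D L where 2: "D \<ge> 0" "\<And>s. Re s \<ge> A \<Longrightarrow> norm (g s) \<le> D * (1 + norm s) ^ L"
    using half_plane_polyE[OF assms(2) A] by blast
  have "norm (f s + g s) \<le> (C + D) * (1 + norm s) ^ (K + L)" if "Re s \<ge> A" for s
  proof -
    have "norm (f s + g s) \<le> C * (1 + norm s) ^ K + D * (1 + norm s) ^ L"
      using 1 2 that by (meson add_mono norm_triangle_le)
    also have "\<dots> \<le> C * (1 + norm s) ^ (K + L) + D * (1 + norm s) ^ (K + L)"
      using 1 2 by (intro add_mono mult_left_mono power_increasing) auto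
    finally show ?thesis by (simp add: algebra_simps)
  qed
  thus "\<exists>C K. C \<ge> 0 \<and> (\<forall>s. Re s \<ge> A \<longrightarrow> norm (f s + g s) \<le> C * (1 + norm s) ^ K)"
    using 1(1) 2(1) by (intro exI[of _ "C + D"] exI[of _ "K + L"]) auto
qed

lemma half_plane_poly_minus:
  "half_plane_poly \<sigma> f \<Longrightarrow> half_plane_poly \<sigma> (\<lambda>s. - f s)"
  using half_plane_poly_mult[OF half_plane_poly_const[of \<sigma> "-1"], of f] by simp

lemma half_plane_poly_diff:
  "half_plane_poly \<sigma> f \<Longrightarrow> half_plane_poly \<sigma> g \<Longrightarrow> half_plane_poly \<sigma> (\<lambda>s. f s - g s)"
  using half_plane_poly_add[OF _ half_plane_poly_minus, of \<sigma> f g] by simp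

lemma half_plane_poly_sum:
  "(\<And>i. i \<in> I \<Longrightarrow> half_plane_poly \<sigma> (f i)) \<Longrightarrow> half_plane_poly \<sigma> (\<lambda>s. \<Sum>i\<in>I. f i s)"
  by (induction I rule: infinite_finite_induct)
     (auto intro!: half_plane_poly_const half_plane_poly_add)

lemma half_plane_poly_prod:
  "(\<And>i. i \<in> I \<Longrightarrow> half_plane_poly \<sigma> (f i)) \<Longrightarrow> half_plane_poly \<sigma> (\<lambda>s. \<Prod>i\<in>I. f i s)"
  by (induction I rule: infinite_finite_induct)
     (auto intro!: half_plane_poly_const half_plane_poly_mult)

lemma half_plane_poly_gbinomial: "half_plane_poly \<sigma> (\<lambda>s. (1 - s) gchoose k)"
  unfolding gbinomial_prod_rev divide_inverse
  by (intro half_plane_poly_mult half_plane_poly_prod half_plane_poly_diff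
            half_plane_poly_const half_plane_poly_ident)

lemma half_plane_poly_shift:
  assumes "half_plane_poly (\<sigma> + Re c) f"
  shows "half_plane_poly \<sigma> (\<lambda>s. f (s + c))"
  unfolding half_plane_poly_def
proof (intro conjI allI impI)
  show "(\<lambda>s. f (s + c)) holomorphic_on {s. Re s > \<sigma>}"
    by (rule holomorphic_on_compose_gen[OF _ half_plane_poly_holomorphic[OF assms], unfolded o_def])
       (auto intro!: holomorphic_intros)
  fix A assume "A > \<sigma>"
  then have A: "A + Re c > \<sigma> + Re c" by simp
  obtain C K where 1: "C \<ge> 0" "\<And>s. Re s \<ge> A + Re c \<Longrightarrow> norm (f s) \<le> C * (1 + norm s) ^ K"
    using half_plane_polyE[OF assms(1) A] by blast
  have "norm (f (s + c)) \<le> (C * (1 + norm c) ^ K) * (1 + norm s) ^ K" if "Re s \<ge> A" for s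
  proof -
    have "norm (f (s + c)) \<le> C * (1 + norm (s + c)) ^ K"
      using that by (intro 1) auto
    also have "1 + norm (s + c) \<le> (1 + norm c) * (1 + norm s)"
      using norm_triangle_ineq[of s c] mult_nonneg_nonneg[OF norm_ge_zero norm_ge_zero, of c s]
      unfolding distrib_left distrib_right by linarith
    hence "C * (1 + norm (s + c)) ^ K \<le> C * ((1 + norm c) * (1 + norm s)) ^ K"
      using 1(1) by (intro mult_left_mono power_mono) auto
    finally show ?thesis by (simp add: power_mult_distrib mult_ac)
  qed
  thus "\<exists>C K. C \<ge> 0 \<and> (\<forall>s. Re s \<ge> A \<longrightarrow> norm (f (s + c)) \<le> C * (1 + norm s) ^ K)"
    using 1(1) by (intro exI[of _ "C * (1 + norm c) ^ K"] exI[of _ K] conjI allI impI) auto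
qed

lemma half_plane_poly_mono: "half_plane_poly \<sigma> f \<Longrightarrow> \<sigma> \<le> \<tau> \<Longrightarrow> half_plane_poly \<tau> f"
  unfolding half_plane_poly_def
  by (auto elim!: holomorphic_on_subset)

lemma half_plane_poly_cong:
  assumes "half_plane_poly \<sigma> f" "\<And>s. Re s > \<sigma> \<Longrightarrow> f s = g s"
  shows "half_plane_poly \<sigma> g"
proof -
  have "g holomorphic_on {s. Re s > \<sigma>}"
    using half_plane_poly_holomorphic[OF assms(1)]
    by (rule holomorphic_transform) (use assms(2) in auto)
  moreover have "norm (g s) = norm (f s)" if "Re s \<ge> A" "A > \<sigma>" for s A
    using assms(2)[of s] that by simp
  ultimately show ?thesis
    using assms(1) unfolding half_plane_poly_def by metis
qed

lemma summable_Suc_powr: "p > 1 \<Longrightarrow> summable (\<lambda>n. real (Suc n) powr (-p))"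
  by (subst summable_Suc_iff) (auto simp: summable_real_powr_iff)

text \<open>Weierstrass M-test: one exponent \<open>K\<close> for all \<open>n\<close> lets the
  growth factor be pulled out of the sum, and p > 1 makes the rest summable. Termwise
  differentiation is included because the derivative of \<open>zeta_reg\<close> at 1 is computed
  from such a series.\<close>

lemma half_plane_poly_series:
  fixes f :: "nat \<Rightarrow> complex \<Rightarrow> complex"
  assumes deriv: "\<And>n s. Re s > \<sigma> \<Longrightarrow> (f n has_field_derivative f' n s) (at s)"
  assumes bound: "\<And>A. A > \<sigma> \<Longrightarrow> \<exists>C K p. C \<ge> 0 \<and> p > 1 \<and> (\<forall>s n. Re s \<ge> A \<longrightarrow>
             norm (f n s) \<le> C * (1 + norm s) ^ K * real (Suc n) powr (-p))"
  shows "half_plane_poly \<sigma> (\<lambda>s. \<Sum>n. f n s)"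
    and "Re s > \<sigma> \<Longrightarrow> summable (\<lambda>n. f n s)"
    and "Re s > \<sigma> \<Longrightarrow> ((\<lambda>s. \<Sum>n. f n s) has_field_derivative (\<Sum>n. f' n s)) (at s)"
proof -
  let ?S = "{s. Re s > \<sigma>}"
  have op: "open ?S" by (rule open_halfspace_Re_gt)
  have "\<exists>d h. 0 < d \<and> summable h \<and> range h \<subseteq> \<real>\<^sub>\<ge>\<^sub>0 \<and>
          (\<forall>\<^sub>F n in sequentially. \<forall>y\<in>ball s d \<inter> ?S. norm (f n y) \<le> norm (h n :: complex))"
    if s: "s \<in> ?S" for s
  proof -
    \<comment> \<open>Half of the distance to the boundary: the ball of radius \<open>d\<close>
      around \<open>s\<close> then stays in Re y \<ge> \<sigma> + d, where a single bound
      serves.\<close>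
    define d where "d = (Re s - \<sigma>) / 2"
    have d: "d > 0" "\<sigma> < \<sigma> + d" using s by (auto simp: d_def)
    obtain C K p where C: "C \<ge> 0" "p > 1" "\<And>s n. Re s \<ge> \<sigma> + d \<Longrightarrow>
             norm (f n s) \<le> C * (1 + norm s) ^ K * real (Suc n) powr (-p)"
      using bound[OF d(2)] by metis
    define h where "h = (\<lambda>n. C * (1 + norm s + d) ^ K * real (Suc n) powr (-p))"
    have h: "summable h" unfolding h_def by (intro summable_mult summable_Suc_powr C)
    have h0: "h n \<ge> 0" for n unfolding h_def using C d by (auto intro!: mult_nonneg_nonneg)
    have "norm (f n y) \<le> h n" if y: "y \<in> ball s d" for n y
    proof -
      have dist: "norm (s - y) < d" using y by (simp add: dist_norm)
      have "\<bar>Re (s - y)\<bar> < d" using dist abs_Re_le_cmod le_less_trans by blast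
      hence "Re y > Re s - d" by simp
      moreover have "Re s = \<sigma> + 2 * d" by (simp add: d_def field_simps)
      ultimately have "Re y \<ge> \<sigma> + d" by linarith
      hence "norm (f n y) \<le> C * (1 + norm y) ^ K * real (Suc n) powr (-p)" by (rule C)
      also have "norm y \<le> norm s + d"
        using norm_triangle_ineq2[of y s] dist by (simp add: norm_minus_commute)
      hence "C * (1 + norm y) ^ K * real (Suc n) powr (-p) \<le> h n" unfolding h_def
        using C(1) by (intro mult_right_mono mult_left_mono power_mono) simp_all
      finally show ?thesis .
    qed
    hence "\<forall>\<^sub>F n in sequentially. \<forall>y\<in>ball s d \<inter> ?S. norm (f n y) \<le> norm (of_real (h n) :: complex)"
      using h0 by auto
    moreover have "summable (\<lambda>n. of_real (h n) :: complex)" using h by simp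
    moreover have "range (\<lambda>n. of_real (h n) :: complex) \<subseteq> \<real>\<^sub>\<ge>\<^sub>0" using h0 by auto
    ultimately show ?thesis using d(1)
      by (intro exI[of _ d] exI[of _ "\<lambda>n. of_real (h n)"] conjI)
  qed
  from series_and_derivative_comparison_complex[OF op deriv this]
  obtain g g' where g: "\<And>s. Re s > \<sigma> \<Longrightarrow> (\<lambda>n. f n s) sums g s"
    "\<And>s. Re s > \<sigma> \<Longrightarrow> (\<lambda>n. f' n s) sums g' s"
    "\<And>s. Re s > \<sigma> \<Longrightarrow> (g has_field_derivative g' s) (at s)"
    by auto
  show summ: "summable (\<lambda>n. f n s)" if "Re s > \<sigma>" for s using g(1)[OF that] by (simp add: sums_iff)
  show der: "((\<lambda>s. \<Sum>n. f n s) has_field_derivative (\<Sum>n. f' n s)) (at s)" if "Re s > \<sigma>" for s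
  proof -
    have "(g has_field_derivative (\<Sum>n. f' n s)) (at s)"
      using g(2,3)[OF that] by (simp add: sums_iff)
    thus ?thesis
    proof (rule has_field_derivative_transform_within_open[OF _ op])
      show "s \<in> ?S" using that by simp
    qed (use g(1) in \<open>auto simp: sums_iff\<close>)
  qed
  show "half_plane_poly \<sigma> (\<lambda>s. \<Sum>n. f n s)"
    unfolding half_plane_poly_def
  proof (intro conjI allI impI)
    show "(\<lambda>s. \<Sum>n. f n s) holomorphic_on {s. Re s > \<sigma>}"
      by (rule holomorphic_on_open[THEN iffD2, OF op]) (use der in auto)
    fix A assume A: "A > \<sigma>"
    obtain C K p where C: "C \<ge> 0" "p > 1" "\<And>s n. Re s \<ge> A \<Longrightarrow>
             norm (f n s) \<le> C * (1 + norm s) ^ K * real (Suc n) powr (-p)"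
      using bound[OF A] by metis
    define D where "D = C * (\<Sum>n. real (Suc n) powr (-p))"
    have "norm (\<Sum>n. f n s) \<le> D * (1 + norm s) ^ K" if s: "Re s \<ge> A" for s
    proof -
      have *: "summable (\<lambda>n. C * (1 + norm s) ^ K * real (Suc n) powr (-p))"
        by (intro summable_mult summable_Suc_powr C)
      have "norm (\<Sum>n. f n s) \<le> (\<Sum>n. C * (1 + norm s) ^ K * real (Suc n) powr (-p))"
        by (rule norm_suminf_le[OF C(3)[OF s] *])
      also have "\<dots> = D * (1 + norm s) ^ K"
        by (subst suminf_mult[OF summable_Suc_powr[OF C(2)]]) (simp add: D_def)
      finally show ?thesis .
    qed
    moreover have "D \<ge> 0" unfolding D_def using C by (intro mult_nonneg_nonneg suminf_nonneg summable_Suc_powr) auto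
    ultimately show "\<exists>C K. C \<ge> 0 \<and> (\<forall>s. Re s \<ge> A \<longrightarrow> norm (\<Sum>n. f n s) \<le> C * (1 + norm s) ^ K)" by blast
  qed
qed

subsection \<open>Continuation of the zeta function\<close>

text \<open>
  Summing the Taylor expansion of \<open>(n + 1)\<^sup>1\<^sup>-\<^sup>s\<close> around \<open>n\<close> over all \<open>n \<ge> 1\<close> telescopes on the left and
  expresses \<open>(s - 1) \<zeta>(s)\<close> through \<open>\<zeta>(s + 1), \<zeta>(s + 2), \<dots>\<close>. The remainder after \<open>K\<close> terms is summable for
  \<open>Re s > 1 - K\<close>, so each step extends the half-plane of holomorphy by one. The index \<open>n\<close> below is shifted by one.
\<close>

definition powr_remainder :: "nat \<Rightarrow> nat \<Rightarrow> complex \<Rightarrow> complex" where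
  "powr_remainder K n s = of_nat (Suc (Suc n)) powr (1 - s) -
     (\<Sum>k\<le>K. ((1 - s) gchoose k) * of_nat (Suc n) powr (1 - s - of_nat k))"

text \<open>Taylor's theorem for u powr (1 - s) on the segment from n + 1 to n + 2. The hypothesis
  makes u powr (- (Re s + K)) nonincreasing, so it is largest at the left end. The factor K + 1 is
  (K + 1)! / K!, as \<open>complex_Taylor\<close> divides only by K!.\<close>

lemma norm_powr_remainder_le:
  assumes "Re s + real K \<ge> 0"
  shows "norm (powr_remainder K n s) \<le>
           (real K + 1) * norm ((1 - s) gchoose (Suc K)) * real (Suc n) powr (- (Re s + real K))"
proof -
  define c where "c = (\<lambda>i. \<Prod>j = 0..<i. 1 - s - of_nat j)"
  define f where "f = (\<lambda>i z. c i * z powr (1 - s - of_nat i))"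
  define S where "S = closed_segment (of_nat (Suc n)) (of_nat (Suc (Suc n)) :: complex)"
  have S: "\<exists>u. z = of_real u \<and> u \<ge> real (Suc n)" if z: "z \<in> S" for z
  proof -
    from z obtain t where t: "z = (1 - t) *\<^sub>R of_nat (Suc n) + t *\<^sub>R of_nat (Suc (Suc n))"
       "0 \<le> t" "t \<le> 1" by (auto simp: S_def closed_segment_def)
    have "z = of_real (real (Suc n) + t)" by (simp add: t scaleR_conv_of_real algebra_simps)
    with t(2) show ?thesis by (intro exI[of _ "real (Suc n) + t"]) auto
  qed
  have c_Suc: "c (Suc i) = c i * (1 - s - of_nat i)" for i by (simp add: c_def)
  define B where "B = norm (c (Suc K)) * real (Suc n) powr (- (Re s + real K))"
  have "norm (f 0 (of_nat (Suc (Suc n))) - (\<Sum>i\<le>K. f i (of_nat (Suc n)) *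
          (of_nat (Suc (Suc n)) - of_nat (Suc n)) ^ i / fact i))
        \<le> B * norm (of_nat (Suc (Suc n)) - of_nat (Suc n) :: complex) ^ Suc K / fact K"
  proof (rule complex_Taylor[of S])
    show "convex S" by (simp add: S_def)
    show "of_nat (Suc n) \<in> S" "of_nat (Suc (Suc n)) \<in> S" by (auto simp: S_def)
    show "(f i has_field_derivative f (Suc i) z) (at z within S)" if zS: "z \<in> S" for i z
    proof -
      obtain u where u: "z = of_real u" "u \<ge> real (Suc n)" using S[OF zS] by blast
      have z: "z \<notin> \<real>\<^sub>\<le>\<^sub>0" using u by (auto simp: complex_nonpos_Reals_iff)
      have "(f i has_field_derivative (c i * ((1 - s - of_nat i) * z powr (1 - s - of_nat i - 1)))) (at z)"
        unfolding f_def by (intro DERIV_cmult has_field_derivative_powr z)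
      also have "c i * ((1 - s - of_nat i) * z powr (1 - s - of_nat i - 1)) = f (Suc i) z"
        by (simp add: f_def c_Suc algebra_simps)
      finally show ?thesis by (rule has_field_derivative_at_within)
    qed
    show "norm (f (Suc K) z) \<le> B" if zS: "z \<in> S" for z
    proof -
      obtain u where u: "z = of_real u" "u \<ge> real (Suc n)" using S[OF zS] by blast
      have "norm (f (Suc K) z) = norm (c (Suc K)) * u powr (- (Re s + real K))"
        using u by (simp add: f_def norm_mult norm_powr_real_powr algebra_simps)
      also have "u powr (- (Re s + real K)) \<le> real (Suc n) powr (- (Re s + real K))"
        using u assms by (intro powr_mono2') auto
      finally show ?thesis by (simp add: B_def mult_left_mono)
    qed
  qed
  also have "f 0 (of_nat (Suc (Suc n))) - (\<Sum>i\<le>K. f i (of_nat (Suc n)) *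
          (of_nat (Suc (Suc n)) - of_nat (Suc n)) ^ i / fact i) = powr_remainder K n s"
    unfolding powr_remainder_def f_def c_def by (simp add: gbinomial_prod_rev)
  also have "B * norm (of_nat (Suc (Suc n)) - of_nat (Suc n) :: complex) ^ Suc K / fact K =
      (real K + 1) * norm ((1 - s) gchoose (Suc K)) * real (Suc n) powr (- (Re s + real K))"
  proof -
    have "c (Suc K) = fact (Suc K) * ((1 - s) gchoose (Suc K))"
      unfolding c_def by (rule gbinomial_mult_fact[symmetric])
    hence "norm (c (Suc K)) = fact (Suc K) * norm ((1 - s) gchoose (Suc K))"
      by (simp only: norm_mult norm_fact)
    thus ?thesis by (simp add: B_def)
  qed
  finally show ?thesis .
qed

lemma powr_remainder_entire: "powr_remainder K n holomorphic_on UNIV"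
  unfolding powr_remainder_def gbinomial_prod_rev by (intro holomorphic_intros) auto

lemma powr_remainder_has_deriv:
  "(powr_remainder K n has_field_derivative deriv (powr_remainder K n) s) (at s)"
  using holomorphic_derivI[OF powr_remainder_entire] by auto

lemma powr_remainder_bound:
  assumes "A > 1 - real K"
  shows "\<exists>C L p. C \<ge> 0 \<and> p > 1 \<and> (\<forall>s n. Re s \<ge> A \<longrightarrow>
             norm (powr_remainder K n s) \<le> C * (1 + norm s) ^ L * real (Suc n) powr (-p))"
proof -
  obtain C L where C: "C \<ge> 0" "\<And>s. Re s \<ge> A \<Longrightarrow> norm ((1 - s) gchoose (Suc K)) \<le> C * (1 + norm s) ^ L"
    using half_plane_polyE[OF half_plane_poly_gbinomial[of "A - 1" "Suc K"], of A] by auto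
  define p where "p = A + real K"
  have p: "p > 1" using assms by (simp add: p_def)
  have "norm (powr_remainder K n s) \<le> ((real K + 1) * C) * (1 + norm s) ^ L * real (Suc n) powr (-p)"
    if s: "Re s \<ge> A" for s n
  proof -
    have "norm (powr_remainder K n s) \<le>
           (real K + 1) * norm ((1 - s) gchoose (Suc K)) * real (Suc n) powr (- (Re s + real K))"
      using s assms by (intro norm_powr_remainder_le) auto
    also have "\<dots> \<le> (real K + 1) * (C * (1 + norm s) ^ L) * real (Suc n) powr (-p)"
      using C(1) s by (intro mult_mono C(2) powr_mono) (auto simp: p_def)
    finally show ?thesis by (simp add: mult_ac)
  qed
  thus ?thesis using C(1) p by (intro exI[of _ "(real K + 1) * C"] exI[of _ L] exI[of _ p]) auto
qed

lemmas powr_remainder_series =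
  half_plane_poly_series[of "1 - real K" "powr_remainder K" "\<lambda>n. deriv (powr_remainder K n)" for K,
    OF powr_remainder_has_deriv powr_remainder_bound]

section \<open>The Dirichlet series of \<zeta> and its extension, half-plane by half-plane\<close>

definition dzeta :: "complex \<Rightarrow> complex" where
  "dzeta s = (\<Sum>n. 1 / of_nat (Suc n) powr s)"

lemma norm_inverse_Suc_powr: "norm (1 / of_nat (Suc n) powr s :: complex) = real (Suc n) powr (- Re s)"
  using norm_powr_real_powr[of "of_nat (Suc n)" s]
  by (simp add: norm_divide powr_minus_divide del: of_nat_Suc)

lemma half_plane_poly_dzeta: "half_plane_poly 1 dzeta"
  and summable_dzeta: "Re s > 1 \<Longrightarrow> summable (\<lambda>n. 1 / of_nat (Suc n) powr s :: complex)"
proof -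
  have hd: "((\<lambda>s. 1 / of_nat (Suc n) powr s) has_field_derivative deriv (\<lambda>s. 1 / of_nat (Suc n) powr s) s) (at s)"
    for n and s :: complex
    by (rule holomorphic_derivI[of _ UNIV]) (auto intro!: holomorphic_intros simp del: of_nat_Suc)
  have bd: "\<exists>C K p. C \<ge> 0 \<and> p > 1 \<and> (\<forall>s n. Re s \<ge> A \<longrightarrow>
             norm (1 / of_nat (Suc n) powr s :: complex) \<le> C * (1 + norm s) ^ K * real (Suc n) powr (-p))"
    if "A > 1" for A
    using that unfolding norm_inverse_Suc_powr
    by (intro exI[of _ 1] exI[of _ 0] exI[of _ A]) (auto intro!: powr_mono simp del: of_nat_Suc)
  note * = half_plane_poly_series[of 1 "\<lambda>n s. 1 / of_nat (Suc n) powr s" _, OF hd bd]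
  show "half_plane_poly 1 dzeta" using *(1) unfolding dzeta_def[abs_def] .
  show "Re s > 1 \<Longrightarrow> summable (\<lambda>n. 1 / of_nat (Suc n) powr s :: complex)" by (rule *(2))
qed

lemma dzeta_recurrence:
  assumes s: "Re s > 1" and K: "K \<ge> 1"
  shows "(s - 1) * dzeta s = 1 + (\<Sum>k=2..K. ((1 - s) gchoose k) * dzeta (s + of_nat (k - 1)))
           + (\<Sum>n. powr_remainder K n s)"
proof -
  define t where "t = (\<lambda>k n. of_nat (Suc n) powr (1 - s - of_nat k) :: complex)"
  have "filterlim (\<lambda>n. real (Suc n)) at_top sequentially"
    by (rule filterlim_compose[OF filterlim_real_sequentially filterlim_Suc])
  then have "(\<lambda>n. real (Suc n) powr (- (Re s - 1))) \<longlonglongrightarrow> 0"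
    by (rule tendsto_neg_powr[rotated]) (use s in simp)
  then have "(\<lambda>n. norm (t 0 n)) \<longlonglongrightarrow> 0"
    by (rule Lim_transform_eventually)
       (auto simp: t_def norm_powr_real_powr simp del: of_nat_Suc)
  then have "t 0 \<longlonglongrightarrow> 0" by (rule tendsto_norm_zero_cancel)
  then have tele: "(\<lambda>n. t 0 (Suc n) - t 0 n) sums (0 - t 0 0)"
    by (rule telescope_sums)
  have tk: "t k sums dzeta (s + of_nat (k - 1))" if "k \<ge> 1" for k
  proof -
    have *: "t k = (\<lambda>n. 1 / of_nat (Suc n) powr (s + of_nat (k - 1)))"
      using that by (auto simp: t_def fun_eq_iff powr_minus_divide[symmetric] of_nat_diff
           simp del: of_nat_Suc) (simp add: algebra_simps)
    show ?thesis unfolding * dzeta_def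
      by (intro summable_sums summable_dzeta) (use s in auto)
  qed
  have "(\<lambda>n. (t 0 (Suc n) - t 0 n) - (\<Sum>k=1..K. ((1 - s) gchoose k) * t k n))
          sums ((0 - t 0 0) - (\<Sum>k=1..K. ((1 - s) gchoose k) * dzeta (s + of_nat (k - 1))))"
    by (intro sums_diff tele sums_sum sums_mult tk) auto
  moreover have "(t 0 (Suc n) - t 0 n) - (\<Sum>k=1..K. ((1 - s) gchoose k) * t k n) = powr_remainder K n s" for n
  proof -
    have "{..K} = insert 0 {1..K}" using K by auto
    hence "(\<Sum>k\<le>K. ((1 - s) gchoose k) * t k n) = t 0 n + (\<Sum>k=1..K. ((1 - s) gchoose k) * t k n)"
      by simp
    thus ?thesis unfolding powr_remainder_def t_def by (simp add: algebra_simps)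
  qed
  ultimately have "(\<Sum>n. powr_remainder K n s) =
      - 1 - (\<Sum>k=1..K. ((1 - s) gchoose k) * dzeta (s + of_nat (k - 1)))"
    by (simp add: sums_iff t_def)
  \<comment> \<open>The term for k = 1 is (1 - s) times \<open>dzeta s\<close>; moved to the other
    side it becomes the left side of the claim.\<close>
  moreover have "{1..K} = insert 1 {2..K}" using K by auto
  ultimately show ?thesis by (simp add: algebra_simps)
qed

text \<open>The last factor of the binomial coefficient is, up to sign, s + (k - 1) - 1. That is
  exactly the factor that turns a zeta value at s + (k - 1) into the pole-free function being
  continued.\<close>

lemma gbinomial_dzeta:
  assumes "k \<ge> 2"
  shows "((1 - s) gchoose k) * d =
           - (((1 - s) gchoose (k - 1)) / of_nat k * ((s + of_nat (k - 1) - 1) * d))"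
proof -
  obtain m where k: "k = Suc m" using assms by (cases k) auto
  have *: "((1 - s) gchoose Suc m) = ((1 - s) gchoose m) * (1 - s - of_nat m) / of_nat (Suc m)"
    by (simp add: gbinomial_prod_rev field_simps)
  show ?thesis unfolding k *
    by (simp add: algebra_simps diff_divide_distrib add_divide_distrib del: of_nat_Suc)
qed

text \<open>Taking K = j + 1 makes the remainder series converge for Re s > 1 - (j + 1), and there
  every shifted argument s + (k - 1) with k \<ge> 2 lies in the half-plane where \<open>Z\<close> is
  already known.\<close>

lemma zeta_continuation_step:
  assumes Z: "half_plane_poly (1 - real j) Z" and eq: "\<And>s. Re s > 1 \<Longrightarrow> Z s = (s - 1) * dzeta s"
  shows "\<exists>Z'. half_plane_poly (1 - real (Suc j)) Z' \<and> (\<forall>s. Re s > 1 \<longrightarrow> Z' s = (s - 1) * dzeta s)"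
proof (intro exI conjI allI impI)
  let ?Z' = "\<lambda>s. 1 - (\<Sum>k=2..Suc j. (((1 - s) gchoose (k - 1)) * (1 / of_nat k)) * Z (s + of_nat (k - 1)))
           + (\<Sum>n. powr_remainder (Suc j) n s)"
  show "half_plane_poly (1 - real (Suc j)) ?Z'"
    by (intro half_plane_poly_add half_plane_poly_diff half_plane_poly_const half_plane_poly_sum
          half_plane_poly_mult half_plane_poly_gbinomial powr_remainder_series(1)
          half_plane_poly_shift half_plane_poly_mono[OF Z]) auto
  fix s :: complex assume s: "Re s > 1"
  have "(((1 - s) gchoose (k - 1)) * (1 / of_nat k)) * Z (s + of_nat (k - 1)) =
          - (((1 - s) gchoose k) * dzeta (s + of_nat (k - 1)))" if "k \<in> {2..Suc j}" for k
  proof -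
    have "Z (s + of_nat (k - 1)) = (s + of_nat (k - 1) - 1) * dzeta (s + of_nat (k - 1))"
      using s that by (intro eq) auto
    thus ?thesis using that by (subst gbinomial_dzeta) auto
  qed
  hence "(\<Sum>k=2..Suc j. (((1 - s) gchoose (k - 1)) * (1 / of_nat k)) * Z (s + of_nat (k - 1))) =
        (\<Sum>k=2..Suc j. - (((1 - s) gchoose k) * dzeta (s + of_nat (k - 1))))"
    by (rule sum.cong[OF refl])
  thus "?Z' s = (s - 1) * dzeta s"
    using dzeta_recurrence[OF s, of "Suc j"] by (simp add: sum_negf)
qed

lemma zeta_continuation_half_plane:
  "\<exists>Z. half_plane_poly (1 - real j) Z \<and> (\<forall>s. Re s > 1 \<longrightarrow> Z s = (s - 1) * dzeta s)"
proof (induction j)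
  case 0
  have "half_plane_poly 1 (\<lambda>s. (s - 1) * dzeta s)"
    by (intro half_plane_poly_mult half_plane_poly_diff half_plane_poly_ident
          half_plane_poly_const half_plane_poly_dzeta)
  thus ?case by auto
qed (metis zeta_continuation_step)

lemma half_plane_identity:
  assumes "f holomorphic_on {s. Re s > \<sigma>}" "g holomorphic_on {s. Re s > \<sigma>}"
      and "\<And>s. Re s > \<tau> \<Longrightarrow> f s = g s" and "Re s > \<sigma>"
  shows "f s = g s"
proof (rule analytic_continuation_open[of "{s. Re s > max \<sigma> \<tau>}" "{s. Re s > \<sigma>}" f g])
  have "of_real (max \<sigma> \<tau> + 1) \<in> {s. Re s > max \<sigma> \<tau>}" by auto
  thus "{s. Re s > max \<sigma> \<tau>} \<noteq> {}" by blast
  show "connected {s. Re s > \<sigma>}" by (intro convex_connected convex_halfspace_Re_gt)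
qed (use assms open_halfspace_Re_gt[of "max \<sigma> \<tau>"] open_halfspace_Re_gt[of \<sigma>] in auto)

lemma zeta_continuation_entire:
  "\<exists>Z. (\<forall>\<sigma>. half_plane_poly \<sigma> Z) \<and> (\<forall>s. Re s > 1 \<longrightarrow> Z s = (s - 1) * dzeta s)"
proof -
  obtain Zs where Zs: "\<And>j. half_plane_poly (1 - real j) (Zs j)"
    "\<And>j s. Re s > 1 \<Longrightarrow> Zs j s = (s - 1) * dzeta s"
    using zeta_continuation_half_plane by metis
  \<comment> \<open>\<open>J s\<close> selects one of the continuations whose half-plane contains
    \<open>s\<close>; by the identity theorem the choice does not affect the value.\<close>
  define J where "J = (\<lambda>s. nat \<lceil>1 - Re s\<rceil> + 1)"
  define Z where "Z = (\<lambda>s. Zs (J s) s)"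
  have J: "Re s > 1 - real (J s)" for s unfolding J_def by linarith
  have agree: "Zs i s = Zs j s" if "Re s > 1 - real i" "Re s > 1 - real j" for i j s
  proof (rule half_plane_identity[of "Zs i" "1 - real (min i j)" "Zs j" 1])
    show "Zs i holomorphic_on {s. Re s > 1 - real (min i j)}"
         "Zs j holomorphic_on {s. Re s > 1 - real (min i j)}"
      by (rule half_plane_poly_holomorphic[OF half_plane_poly_mono[OF Zs(1)]]; simp)+
  qed (use that Zs(2) in \<open>auto simp: min_def\<close>)
  have Zj: "half_plane_poly (1 - real j) Z" for j
    by (rule half_plane_poly_cong[OF Zs(1)]) (auto simp: Z_def intro!: agree J)
  have "half_plane_poly \<sigma> Z" for \<sigma>
    by (rule half_plane_poly_mono[OF Zj[of "nat \<lceil>1 - \<sigma>\<rceil>"]]) linarith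
  moreover have "Z s = (s - 1) * dzeta s" if "Re s > 1" for s
    unfolding Z_def using Zs(2)[OF that] .
  ultimately show ?thesis by blast
qed

text \<open>The value at \<open>1\<close> removes the singularity, as \<open>zeta 1 = 0\<close> by convention.\<close>

definition zeta_reg :: "complex \<Rightarrow> complex" where
  "zeta_reg s = (if s = 1 then 1 else (s - 1) * zeta s)"

text \<open>These are the terms of the series \<open>euler_mascheroni_sum\<close>; this is how
  \<gamma> enters the development.\<close>

lemma powr_remainder_1_deriv:
  "deriv (powr_remainder 1 n) 1 =
     inverse (of_nat (n+1)) + of_real (ln (of_nat (n+1))) - of_real (ln (of_nat (n+2)))"
proof -
  have Ln: "Ln (of_nat (Suc m)) = of_real (ln (real (Suc m)))" for m
    by (metis Ln_of_real of_nat_0_less_iff of_real_of_nat_eq zero_less_Suc)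
  have "powr_remainder 1 n = (\<lambda>s. of_nat (Suc (Suc n)) powr (1 - s) - of_nat (Suc n) powr (1 - s)
           - (1 - s) * of_nat (Suc n) powr (- s))"
    by (auto simp: powr_remainder_def fun_eq_iff algebra_simps)
  moreover have "((\<lambda>s. of_nat (Suc (Suc n)) powr (1 - s) - of_nat (Suc n) powr (1 - s)
           - (1 - s) * of_nat (Suc n) powr (- s)) has_field_derivative
      (- Ln (of_nat (Suc (Suc n))) + Ln (of_nat (Suc n)) + inverse (of_nat (Suc n)))) (at 1)"
    unfolding powr_def by (auto intro!: derivative_eq_intros simp: exp_minus exp_of_real simp del: of_nat_Suc)
  ultimately show ?thesis using Ln[of n] Ln[of "Suc n"]
    by (auto dest!: DERIV_imp_deriv simp: add.commute)
qed

lemma powr_remainder_1_at_1: "powr_remainder 1 n 1 = 0"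
  by (simp add: powr_remainder_def del: of_nat_Suc)

text \<open>The three claims share one proof because they concern the same entire function
  \<open>Z\<close>. Only after uniqueness has identified \<open>zeta\<close> with Z s / (s - 1) can
  \<open>Z\<close> be recognized as \<open>zeta_reg\<close>.\<close>

theorem zeta_continuation:
  shows is_zeta_continuation_zeta: "is_zeta_continuation zeta"
    and half_plane_poly_zeta_reg: "half_plane_poly \<sigma> zeta_reg"
    and zeta_reg_has_deriv_1: "(zeta_reg has_field_derivative euler_mascheroni) (at 1)"
proof -
  obtain Z where Z: "\<And>\<sigma>. half_plane_poly \<sigma> Z" "\<And>s. Re s > 1 \<Longrightarrow> Z s = (s - 1) * dzeta s"
    using zeta_continuation_entire by metis
  note rem = powr_remainder_series[of 1, unfolded of_nat_1 diff_self]
  \<comment> \<open>The recurrence with K = 1 contains no shifted zeta values, and its remainder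
    series converges for Re s > 0, hence around 1. At 1 itself every term vanishes, which gives Z 1
    = 1.\<close>
  have Z1: "Z s = 1 + (\<Sum>n. powr_remainder 1 n s)" if "Re s > 0" for s
  proof (rule half_plane_identity[of Z 0 "\<lambda>s. 1 + (\<Sum>n. powr_remainder 1 n s)" 1])
    show "Z holomorphic_on {s. Re s > 0}" by (rule half_plane_poly_holomorphic[OF Z(1)])
    show "(\<lambda>s. 1 + (\<Sum>n. powr_remainder 1 n s)) holomorphic_on {s. Re s > 0}"
      by (intro half_plane_poly_holomorphic half_plane_poly_add half_plane_poly_const rem(1))
  qed (use that Z(2) dzeta_recurrence[of _ 1] in auto)
  have Z_1: "Z 1 = 1" using Z1[of 1] powr_remainder_1_at_1 by simp
  have "((\<lambda>s. 1 + (\<Sum>n. powr_remainder 1 n s)) has_field_derivative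
           0 + (\<Sum>n. deriv (powr_remainder 1 n) 1)) (at 1)"
    by (intro DERIV_add DERIV_const rem(3)) auto
  also have "(\<Sum>n. deriv (powr_remainder 1 n) 1) = euler_mascheroni"
    unfolding powr_remainder_1_deriv using euler_mascheroni_sum[where ?'a = complex] by (simp only: sums_iff)
  finally have "((\<lambda>s. 1 + (\<Sum>n. powr_remainder 1 n s)) has_field_derivative euler_mascheroni) (at 1)"
    by simp
  then have Z'1: "(Z has_field_derivative euler_mascheroni) (at 1)"
    by (rule has_field_derivative_transform_within_open[OF _ open_halfspace_Re_gt[of 0]])
       (use Z1 in auto)
  have Z_hol: "Z holomorphic_on A" for A
  proof -
    have "Z field_differentiable (at s)" for s
      using half_plane_poly_holomorphic[OF Z(1)[of "Re s - 1"]] open_halfspace_Re_gt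
      by (auto simp: holomorphic_on_def at_within_open[of _ "{t. Re t > Re s - 1}"])
    thus ?thesis by (auto simp: holomorphic_on_def intro: field_differentiable_at_within)
  qed
  \<comment> \<open>The value 0 at 1 is the one that \<open>nicely_meromorphic_on\<close> prescribes
    at a pole; Z 1 = 1 shows that 1 is a pole.\<close>
  define z where "z = (\<lambda>s. if s = 1 then 0 else Z s / (s - 1))"
  have z_hol: "z holomorphic_on - {1}"
  proof (rule holomorphic_transform)
    show "(\<lambda>s. Z s / (s - 1)) holomorphic_on - {1}"
      by (intro holomorphic_intros Z_hol) auto
  qed (auto simp: z_def)
  have "z nicely_meromorphic_on UNIV"
  proof (rule nicely_meromorphic_onI_open[where pts = "{1}"])
    show "z analytic_on UNIV - {1}"
      using z_hol by (subst analytic_on_open) (auto simp: Compl_eq_Diff_UNIV)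
    have "is_pole (\<lambda>s. Z s / (s - 1) ^ 1) 1"
      by (rule is_pole_basic[of _ UNIV]) (use Z_1 Z_hol in auto)
    hence "is_pole z 1"
      by (rule is_pole_cong[THEN iffD1, rotated -1])
         (auto simp: z_def eventually_at_filter)
    thus "is_pole z x \<and> z x = 0" if "x \<in> {1}" for x using that by (auto simp: z_def)
    show "isolated_singularity_at z x" for x
    proof (cases "x = 1")
      case True
      show ?thesis unfolding True isolated_singularity_at_def
        using z_hol by (intro exI[of _ 1])
           (auto simp: analytic_on_open open_delete elim!: holomorphic_on_subset)
    next
      case False
      hence "z analytic_on {x}"
        using z_hol by (auto simp: analytic_at intro!: exI[of _ "- {1}"])
      thus ?thesis by (rule isolated_singularity_at_analytic)
    qed
  qed auto
  hence z: "is_zeta_continuation z"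
    by (auto simp: is_zeta_continuation_def z_def Z(2) dzeta_def)
  have "zeta = z" unfolding zeta_def
    by (rule the_equality) (use z is_zeta_continuation_unique in blast)+
  moreover from this have "zeta_reg = Z" by (auto simp: zeta_reg_def z_def Z_1 fun_eq_iff)
  ultimately show "is_zeta_continuation zeta" "half_plane_poly \<sigma> zeta_reg"
    "(zeta_reg has_field_derivative euler_mascheroni) (at 1)"
    using z Z(1) Z'1 by auto
qed

lemma zeta_eq_dzeta: "Re s > 1 \<Longrightarrow> zeta s = dzeta s"
  using is_zeta_continuation_zeta unfolding is_zeta_continuation_def dzeta_def by auto

lemma zeta_eq_zeta_reg: "s \<noteq> 1 \<Longrightarrow> zeta s = zeta_reg s / (s - 1)"
  by (simp add: zeta_reg_def)

lemma zeta_reg_1: "zeta_reg 1 = 1"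
  by (simp add: zeta_reg_def)

lemma zeta_reg_entire: "zeta_reg holomorphic_on A"
proof -
  have "zeta_reg field_differentiable (at s)" for s
    using half_plane_poly_holomorphic[OF half_plane_poly_zeta_reg, of "Re s - 1"] open_halfspace_Re_gt
    by (auto simp: holomorphic_on_def at_within_open[of _ "{t. Re t > Re s - 1}"])
  thus ?thesis by (auto simp: holomorphic_on_def intro: field_differentiable_at_within)
qed

lemma zeta_holomorphic: "zeta holomorphic_on - {1}"
proof (rule holomorphic_transform)
  show "(\<lambda>s. zeta_reg s / (s - 1)) holomorphic_on - {1}"
    by (intro holomorphic_intros zeta_reg_entire) auto
qed (auto simp: zeta_eq_zeta_reg)

subsection \<open>Decay of the Gamma function and shifting vertical lines\<close>

lemma compact_continuous_bound:
  fixes f :: "'a::topological_space \<Rightarrow> 'b::real_normed_vector"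
  assumes "compact S" "continuous_on S f"
  obtains B where "\<And>x. x \<in> S \<Longrightarrow> norm (f x) \<le> B"
proof -
  have "bounded (f ` S)"
    using assms by (intro compact_imp_bounded compact_continuous_image)
  thus ?thesis using that by (auto simp: bounded_iff)
qed

lemma norm_Gamma_le:
  assumes "Re s > 0"
  shows "norm (Gamma s) \<le> Gamma (Re s)"
proof -
  have "norm (integral {0..} (\<lambda>t. of_real t powr (s - 1) / of_real (exp t)))
          \<le> integral {0..} (\<lambda>t. t powr (Re s - 1) / exp t)"
    using Gamma_integral_complex[OF assms] Gamma_integral_real[OF assms]
    by (intro integral_norm_bound_integral)
       (auto simp: norm_divide norm_powr_real_powr has_integral_iff)
  thus ?thesis
    using Gamma_integral_complex[OF assms] Gamma_integral_real[OF assms]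
    by (simp add: has_integral_iff)
qed

text \<open>Every factor s + i has the same imaginary part as s. This turns m applications of the
  functional equation of \<Gamma> into m powers of decay.\<close>

lemma norm_pochhammer_ge: "\<bar>Im s\<bar> ^ m \<le> norm (pochhammer s m)"
proof -
  have "\<bar>Im s\<bar> \<le> norm (s + of_nat i)" for i
    using abs_Im_le_cmod[of "s + of_nat i"] by simp
  hence "(\<Prod>i=0..<m. \<bar>Im s\<bar>) \<le> (\<Prod>i=0..<m. norm (s + of_nat i))"
    by (intro prod_mono) auto
  thus ?thesis by (simp add: pochhammer_prod prod_norm)
qed

text \<open>
  Shifting the argument by the functional equation makes \<open>\<Gamma>\<close> decay faster than any power of
  \<open>Im s\<close> in vertical strips, which is all that is needed against the polynomial growth of \<open>\<zeta>\<close>.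
\<close>

lemma Gamma_strip_decay:
  obtains C where "C \<ge> 0"
    "\<And>s. A \<le> Re s \<Longrightarrow> Re s \<le> B \<Longrightarrow> \<bar>Im s\<bar> \<ge> 1 \<Longrightarrow> norm (Gamma s) \<le> C / \<bar>Im s\<bar> ^ K"
proof -
  \<comment> \<open>m \<ge> K yields the decay, and m \<ge> 1 - A moves the strip into Re s \<ge> 1,
    where \<Gamma> is bounded by its values on a compact real interval.\<close>
  define m where "m = max K (nat \<lceil>1 - A\<rceil>)"
  have m: "m \<ge> K" "A + real m \<ge> 1" unfolding m_def by linarith+
  have "continuous_on {A + real m..B + real m} Gamma"
    using m(2) by (intro continuous_on_Gamma) (auto elim!: nonpos_Ints_cases)
  then obtain C where C: "\<And>x. x \<in> {A + real m..B + real m} \<Longrightarrow> norm (Gamma x) \<le> C"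
    using compact_continuous_bound[OF compact_Icc] by blast
  have "norm (Gamma s) \<le> max C 0 / \<bar>Im s\<bar> ^ K" if s: "A \<le> Re s" "Re s \<le> B" "\<bar>Im s\<bar> \<ge> 1" for s
  proof -
    have "s \<notin> \<int>\<^sub>\<le>\<^sub>0" using s(3) by (auto elim!: nonpos_Ints_cases)
    hence "Gamma s \<noteq> 0" "pochhammer s m = Gamma (s + of_nat m) / Gamma s"
      by (auto simp: Gamma_eq_zero_iff pochhammer_Gamma)
    hence "norm (pochhammer s m) * norm (Gamma s) = norm (Gamma (s + of_nat m))"
      by (simp add: norm_divide)
    also have "\<dots> \<le> Gamma (Re (s + of_nat m))"
      using s m by (intro norm_Gamma_le) auto
    also have "\<dots> \<le> max C 0"
      using C[of "Re s + real m"] s by auto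
    finally have *: "norm (pochhammer s m) * norm (Gamma s) \<le> max C 0" .
    have "\<bar>Im s\<bar> ^ K \<le> \<bar>Im s\<bar> ^ m" using s m by (intro power_increasing) auto
    also have "\<dots> \<le> norm (pochhammer s m)" by (rule norm_pochhammer_ge)
    finally have "\<bar>Im s\<bar> ^ K * norm (Gamma s) \<le> max C 0"
      using * by (meson mult_right_mono norm_ge_zero order_trans)
    thus ?thesis using s by (simp add: field_simps)
  qed
  thus ?thesis using that[of "max C 0"] by auto
qed

section \<open>Integrals over vertical lines and moving them across poles\<close>

lemma integrable_inverse_1_plus_square_lborel: "integrable lborel (\<lambda>t::real. 1 / (1 + t\<^sup>2))"
  using integrable_inverse_1_plus_square
  by (simp add: set_integrable_def inverse_eq_divide)

lemma vertical_line_integrableI: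
  assumes cont: "continuous_on {s. Re s = c} F"
    and bound: "\<And>s. Re s = c \<Longrightarrow> \<bar>Im s\<bar> \<ge> T \<Longrightarrow> norm (F s) \<le> C / (1 + (Im s)\<^sup>2)"
  shows "vertical_line_integrable c F"
proof -
  have cont': "continuous_on A (\<lambda>t. F (Complex c t))" for A
    by (rule continuous_on_compose2[OF cont]) (auto simp: Complex_eq intro!: continuous_intros)
  obtain D where D: "\<And>t. t \<in> {-T..T} \<Longrightarrow> norm (F (Complex c t)) \<le> D"
    using compact_continuous_bound[OF compact_Icc cont'] by blast
  \<comment> \<open>The first summand covers |t| \<ge> T; the second covers |t| < T, where 1 + t^2
    \<le> 1 + T^2.\<close>
  define E where "E = max 0 C + max 0 D * (1 + T\<^sup>2)"
  have E: "norm (F (Complex c t)) \<le> E * (1 / (1 + t\<^sup>2))" for t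
  proof (cases "\<bar>t\<bar> \<ge> T")
    case True
    have "norm (F (Complex c t)) \<le> C / (1 + t\<^sup>2)" using bound[of "Complex c t"] True by simp
    also have "\<dots> \<le> E / (1 + t\<^sup>2)" unfolding E_def
      by (intro divide_right_mono) (auto simp: add_nonneg_nonneg intro: order_trans[of _ "max 0 C"])
    finally show ?thesis by simp
  next
    case False
    hence t: "t \<in> {-T..T}" by auto
    have "t\<^sup>2 \<le> T\<^sup>2" using False by (intro abs_le_square_iff[THEN iffD1]) auto
    hence "max 0 D * (1 + t\<^sup>2) \<le> max 0 D * (1 + T\<^sup>2)" by (intro mult_left_mono) auto
    also have "\<dots> \<le> E" by (simp add: E_def)
    finally have "max 0 D * (1 + t\<^sup>2) \<le> E" .
    moreover have "norm (F (Complex c t)) \<le> max 0 D" using D[OF t] by auto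
    moreover have "1 + t\<^sup>2 > 0" by (simp add: add_pos_nonneg)
    ultimately have "norm (F (Complex c t)) * (1 + t\<^sup>2) \<le> E"
      by (meson less_imp_le mult_right_mono order_trans)
    thus ?thesis using \<open>1 + t\<^sup>2 > 0\<close> by (simp add: field_simps)
  qed
  show ?thesis unfolding vertical_line_integrable_def
  proof (rule Bochner_Integration.integrable_bound)
    show "integrable lborel (\<lambda>t. E * (1 / (1 + t\<^sup>2)))"
      by (intro integrable_mult_right integrable_inverse_1_plus_square_lborel)
    show "(\<lambda>t. F (Complex c t)) \<in> borel_measurable lborel"
      using cont'[of UNIV] by (simp add: borel_measurable_continuous_onI)
    show "AE t in lborel. norm (F (Complex c t)) \<le> norm (E * (1 / (1 + t\<^sup>2)))"
      using E by (intro always_eventually allI) (metis abs_ge_self order_trans real_norm_def)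
  qed
qed

lemma integral_symmetric_tendsto:
  fixes f :: "real \<Rightarrow> complex"
  assumes f: "integrable lborel f"
  shows "(\<lambda>n. integral {- real n..real n} f) \<longlonglongrightarrow> (LINT t|lborel. f t)"
proof -
  have "integral {- real n..real n} f = (LINT t|lborel. indicator {- real n..real n} t *\<^sub>R f t)" for n
  proof -
    have "set_integrable lborel {- real n..real n} f"
      unfolding set_integrable_def using f by (intro integrable_mult_indicator) auto
    from set_borel_integral_eq_integral(2)[OF this] show ?thesis
      by (simp add: set_lebesgue_integral_def)
  qed
  moreover have "(\<lambda>n. LINT t|lborel. indicator {- real n..real n} t *\<^sub>R f t) \<longlonglongrightarrow> (LINT t|lborel. f t)"
  proof (rule integral_dominated_convergence[where w = "\<lambda>t. norm (f t)"])
    show "AE t in lborel. (\<lambda>n. indicator {- real n..real n} t *\<^sub>R f t) \<longlonglongrightarrow> f t"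
    proof (rule AE_I2, rule tendsto_eventually)
      fix t :: real
      have "eventually (\<lambda>n. n \<ge> nat \<lceil>\<bar>t\<bar>\<rceil>) sequentially" by (rule eventually_ge_at_top)
      thus "eventually (\<lambda>n. indicator {- real n..real n} t *\<^sub>R f t = f t) sequentially"
      proof eventually_elim
        case (elim n)
        hence "\<bar>t\<bar> \<le> real n" by linarith
        thus ?case by (auto simp: indicator_def)
      qed
    qed
  qed (use f in \<open>auto simp: indicator_def\<close>)
  ultimately show ?thesis by simp
qed

text \<open>Residue theorem on the rectangle cut out between the two lines by |Im s| \<le> n. As n
  grows, the vertical sides tend to the line integrals, while the horizontal sides vanish: their
  length is fixed and the integrand is of order 1 / n^2. Since \<open>\<sigma> < c1\<close>, the
  closed rectangle lies in an open half-plane whose only singularities are in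
  \<open>P\<close>.\<close>

lemma vertical_line_integral_shift:
  assumes c: "\<sigma> < c1" "c1 < c2" and fin: "finite P"
    and P: "\<And>p. p \<in> P \<Longrightarrow> c1 < Re p \<and> Re p < c2"
    and hol: "F holomorphic_on {s. Re s > \<sigma>} - P"
    and bound: "\<And>s. c1 \<le> Re s \<Longrightarrow> Re s \<le> c2 \<Longrightarrow> \<bar>Im s\<bar> \<ge> T \<Longrightarrow> norm (F s) \<le> C / (1 + (Im s)\<^sup>2)"
  shows "vertical_line_integrable c1 F" "vertical_line_integrable c2 F"
    and "vertical_line_integral c2 F =
           vertical_line_integral c1 F + 2 * of_real pi * \<i> * (\<Sum>p\<in>P. residue F p)"
proof -
  have cont: "continuous_on ({s. Re s > \<sigma>} - P) F" by (rule holomorphic_on_imp_continuous_on[OF hol])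
  show int1: "vertical_line_integrable c1 F"
    by (rule vertical_line_integrableI[OF continuous_on_subset[OF cont] bound])
       (use c P in fastforce)+
  show int2: "vertical_line_integrable c2 F"
    by (rule vertical_line_integrableI[OF continuous_on_subset[OF cont] bound])
       (use c P in fastforce)+
  define a1 a2 a3 a4 where "a1 = (\<lambda>n. Complex c1 (- real n))" and "a2 = (\<lambda>n. Complex c2 (- real n))"
    and "a3 = (\<lambda>n. Complex c2 (real n))" and "a4 = (\<lambda>n. Complex c1 (real n))"
  define hb where "hb = (\<lambda>n. contour_integral (linepath (a1 n) (a2 n)) F)"
  define ht where "ht = (\<lambda>n. contour_integral (linepath (a3 n) (a4 n)) F)"
  define v1 where "v1 = (\<lambda>n. integral {- real n..real n} (\<lambda>t. F (Complex c1 t)))"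
  define v2 where "v2 = (\<lambda>n. integral {- real n..real n} (\<lambda>t. F (Complex c2 t)))"
  define R where "R = 2 * of_real pi * \<i> * (\<Sum>p\<in>P. residue F p)"
  \<comment> \<open>From \<open>n0\<close> on, the horizontal sides lie in the range of
    \<open>bound\<close> and every pole is strictly inside. The sum of all |Im p| is an upper bound
    for each of them that also makes sense for empty \<open>P\<close>.\<close>
  define n0 where "n0 = nat (\<lceil>T\<rceil> + 1) + nat (\<lceil>\<Sum>p\<in>P. \<bar>Im p\<bar>\<rceil> + 1) + 1"
  have n0: "real n \<ge> T" "real n > (\<Sum>p\<in>P. \<bar>Im p\<bar>)" "n > 0" if "n \<ge> n0" for n
  proof -
    have "(\<Sum>p\<in>P. \<bar>Im p\<bar>) \<ge> 0" by (intro sum_nonneg) auto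
    thus "real n \<ge> T" "real n > (\<Sum>p\<in>P. \<bar>Im p\<bar>)" "n > 0"
      using that unfolding n0_def by linarith+
  qed
  have ImP: "\<bar>Im p\<bar> < real n" if "n \<ge> n0" "p \<in> P" for n p
    using n0(2)[OF that(1)] member_le_sum[of p P "\<lambda>p. \<bar>Im p\<bar>"] fin that(2) by auto
  have cint: "F contour_integrable_on linepath a b"
    if "closed_segment a b \<subseteq> {s. Re s > \<sigma>} - P" for a b
    using that by (intro contour_integrable_continuous_linepath continuous_on_subset[OF cont])
  have seg: "closed_segment (a1 n) (a2 n) \<subseteq> {s. Re s > \<sigma>} - P"
      "closed_segment (a2 n) (a3 n) \<subseteq> {s. Re s > \<sigma>} - P"
      "closed_segment (a3 n) (a4 n) \<subseteq> {s. Re s > \<sigma>} - P"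
      "closed_segment (a4 n) (a1 n) \<subseteq> {s. Re s > \<sigma>} - P" if n: "n \<ge> n0" for n
    using c P ImP[OF n] unfolding a1_def a2_def a3_def a4_def
    by (fastforce simp: closed_segment_same_Re closed_segment_same_Im closed_segment_eq_real_ivl)+
  have rect: "hb n + \<i> * v2 n + ht n - \<i> * v1 n = R" if n: "n \<ge> n0" for n
  proof -
    have lt: "- real n < real n" using n0(3)[OF n] by simp
    have right: "contour_integral (linepath (a2 n) (a3 n)) F = \<i> * v2 n"
      unfolding a2_def a3_def v2_def by (rule contour_integral_linepath_same_Re) (use lt in auto)
    have "contour_integral (linepath (a1 n) (a4 n)) F = \<i> * v1 n"
      unfolding a1_def a4_def v1_def by (rule contour_integral_linepath_same_Re) (use lt in auto)
    moreover have "contour_integral (linepath (a4 n) (a1 n)) F = - contour_integral (linepath (a1 n) (a4 n)) F"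
    proof (rule contour_integral_reverse_linepath)
      show "continuous_on (closed_segment (a4 n) (a1 n)) F"
        by (rule continuous_on_subset[OF cont seg(4)[OF n]])
    qed
    ultimately have left: "contour_integral (linepath (a4 n) (a1 n)) F = - (\<i> * v1 n)" by simp
    have rp: "rectpath (a1 n) (a3 n) = linepath (a1 n) (a2 n) +++ linepath (a2 n) (a3 n) +++
                 linepath (a3 n) (a4 n) +++ linepath (a4 n) (a1 n)"
      by (simp add: rectpath_def Let_def a1_def a2_def a3_def a4_def)
    have "contour_integral (rectpath (a1 n) (a3 n)) F = hb n + \<i> * v2 n + ht n - \<i> * v1 n"
      unfolding rp using seg[OF n]
      by (simp add: contour_integral_join contour_integrable_joinI cint valid_path_join left right
            hb_def ht_def)
    moreover have "contour_integral (rectpath (a1 n) (a3 n)) F =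
       2 * pi * \<i> * (\<Sum>p\<in>P. winding_number (rectpath (a1 n) (a3 n)) p * residue F p)"
    proof (rule Residue_theorem[of "{s. Re s > \<sigma>}"])
      have le: "Re (a1 n) \<le> Re (a3 n)" "Im (a1 n) \<le> Im (a3 n)" using c by (auto simp: a1_def a3_def)
      show "connected {s. Re s > \<sigma>}" by (intro convex_connected convex_halfspace_Re_gt)
      show "path_image (rectpath (a1 n) (a3 n)) \<subseteq> {s. Re s > \<sigma>} - P"
        unfolding rp using seg[OF n] by (simp add: path_image_join)
      show "\<forall>z. z \<notin> {s. Re s > \<sigma>} \<longrightarrow> winding_number (rectpath (a1 n) (a3 n)) z = 0"
      proof (intro allI impI winding_number_rectpath_outside le)
        show "z \<notin> cbox (a1 n) (a3 n)" if "z \<notin> {s. Re s > \<sigma>}" for z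
          using that c by (auto simp: in_cbox_complex_iff a1_def)
      qed
    qed (use fin hol in \<open>auto simp: open_halfspace_Re_gt\<close>)
    moreover have "winding_number (rectpath (a1 n) (a3 n)) p = 1" if "p \<in> P" for p
      using P[OF that] ImP[OF n that]
      by (intro winding_number_rectpath) (auto simp: in_box_complex_iff a1_def a3_def)
    ultimately show ?thesis by (simp add: R_def)
  qed
  have C0: "max C 0 / (1 + (real n)\<^sup>2) \<ge> 0" for n by (simp add: add_nonneg_nonneg)
  have Cle: "C / (1 + (real n)\<^sup>2) \<le> max C 0 / (1 + (real n)\<^sup>2)" for n
    by (intro divide_right_mono) (auto simp: add_nonneg_nonneg)
  have hbound: "norm (F s) \<le> max C 0 / (1 + (real n)\<^sup>2)"
    if "n \<ge> n0" "c1 \<le> Re s" "Re s \<le> c2" "\<bar>Im s\<bar> = real n" for n s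
    using bound[of s] n0(1)[OF that(1)] that Cle[of n]
    by (metis order_trans power2_abs)
  have hb: "norm (hb n) \<le> max C 0 / (1 + (real n)\<^sup>2) * norm (a2 n - a1 n)" if n: "n \<ge> n0" for n
    unfolding hb_def using c
    by (intro contour_integral_bound_linepath C0 cint seg[OF n] hbound[OF n])
       (auto simp: a1_def a2_def closed_segment_same_Im closed_segment_eq_real_ivl)
  have ht: "norm (ht n) \<le> max C 0 / (1 + (real n)\<^sup>2) * norm (a4 n - a3 n)" if n: "n \<ge> n0" for n
    unfolding ht_def using c
    by (intro contour_integral_bound_linepath C0 cint seg[OF n] hbound[OF n])
       (auto simp: a3_def a4_def closed_segment_same_Im closed_segment_eq_real_ivl)
  have lim0: "(\<lambda>n. max C 0 / (1 + (real n)\<^sup>2) * norm (Complex (c2 - c1) 0)) \<longlonglongrightarrow> 0"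
    by real_asymp
  have hb0: "hb \<longlonglongrightarrow> 0"
  proof (rule Lim_null_comparison[OF _ lim0])
    have "a2 n - a1 n = Complex (c2 - c1) 0" for n
      by (simp add: a1_def a2_def complex_eq_iff)
    thus "eventually (\<lambda>n. norm (hb n) \<le> max C 0 / (1 + (real n)\<^sup>2) * norm (Complex (c2 - c1) 0)) sequentially"
      using hb by (auto simp: eventually_sequentially intro!: exI[of _ n0])
  qed
  have ht0: "ht \<longlonglongrightarrow> 0"
  proof (rule Lim_null_comparison[OF _ lim0])
    have "norm (a4 n - a3 n) = norm (Complex (c2 - c1) 0)" for n
      by (simp add: a3_def a4_def norm_complex_def power2_commute)
    thus "eventually (\<lambda>n. norm (ht n) \<le> max C 0 / (1 + (real n)\<^sup>2) * norm (Complex (c2 - c1) 0)) sequentially"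
      using ht by (auto simp: eventually_sequentially intro!: exI[of _ n0])
  qed
  have v1: "v1 \<longlonglongrightarrow> (LINT t|lborel. F (Complex c1 t))" and v2: "v2 \<longlonglongrightarrow> (LINT t|lborel. F (Complex c2 t))"
    unfolding v1_def v2_def using int1 int2
    by (auto simp: vertical_line_integrable_def intro!: integral_symmetric_tendsto)
  have "(\<lambda>n. hb n + \<i> * v2 n + ht n - \<i> * v1 n) \<longlonglongrightarrow>
          0 + \<i> * (LINT t|lborel. F (Complex c2 t)) + 0 - \<i> * (LINT t|lborel. F (Complex c1 t))"
    by (intro tendsto_intros hb0 ht0 v1 v2)
  moreover have "(\<lambda>n. hb n + \<i> * v2 n + ht n - \<i> * v1 n) \<longlonglongrightarrow> R"
    by (rule tendsto_eventually) (use rect in \<open>auto simp: eventually_sequentially\<close>)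
  ultimately have "0 + \<i> * (LINT t|lborel. F (Complex c2 t)) + 0 - \<i> * (LINT t|lborel. F (Complex c1 t)) = R"
    by (rule LIMSEQ_unique)
  thus "vertical_line_integral c2 F =
           vertical_line_integral c1 F + 2 * of_real pi * \<i> * (\<Sum>p\<in>P. residue F p)"
    by (simp add: vertical_line_integral_def R_def algebra_simps)
qed

text \<open>Decay of order K + 2 is requested from \<Gamma>: K powers cancel the growth of
  \<open>H\<close>, and two remain to make the line integral converge.\<close>

lemma Gamma_times_poly_decay:
  assumes H: "\<And>s. A \<le> Re s \<Longrightarrow> Re s \<le> B \<Longrightarrow> \<bar>Im s\<bar> \<ge> T \<Longrightarrow> norm (H s) \<le> C * (1 + norm s) ^ K"
  obtains D T' where "D \<ge> 0" "\<And>s. A \<le> Re s \<Longrightarrow> Re s \<le> B \<Longrightarrow> \<bar>Im s\<bar> \<ge> T' \<Longrightarrow>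
                          norm (Gamma s * H s) \<le> D / (1 + (Im s)\<^sup>2)"
proof -
  obtain G where G: "G \<ge> 0"
    "\<And>s. A \<le> Re s \<Longrightarrow> Re s \<le> B \<Longrightarrow> \<bar>Im s\<bar> \<ge> 1 \<Longrightarrow> norm (Gamma s) \<le> G / \<bar>Im s\<bar> ^ (K + 2)"
    using Gamma_strip_decay[of A B "K + 2"] by blast
  \<comment> \<open>Inside the strip, \<open>E\<close> bounds (1 + norm s) / |Im s| as soon as |Im
    s| \<ge> 1.\<close>
  define E where "E = 2 + \<bar>A\<bar> + \<bar>B\<bar>"
  define C' where "C' = max C 0"
  have "norm (Gamma s * H s) \<le> (2 * G * C' * E ^ K) / (1 + (Im s)\<^sup>2)"
    if s: "A \<le> Re s" "Re s \<le> B" "\<bar>Im s\<bar> \<ge> max T 1" for s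
  proof -
    let ?t = "\<bar>Im s\<bar>"
    have t: "?t \<ge> 1" "?t > 0" using s by auto
    have "norm s \<le> \<bar>Re s\<bar> + ?t" by (rule cmod_le)
    also have "\<bar>Re s\<bar> \<le> (\<bar>A\<bar> + \<bar>B\<bar>) * 1" using s by auto
    also have "\<dots> \<le> (\<bar>A\<bar> + \<bar>B\<bar>) * ?t" using t by (intro mult_left_mono) auto
    finally have "1 + norm s \<le> E * ?t" using t by (simp add: E_def algebra_simps)
    hence "C' * (1 + norm s) ^ K \<le> C' * (E * ?t) ^ K"
      by (intro mult_left_mono power_mono) (auto simp: C'_def)
    moreover have "norm (H s) \<le> C * (1 + norm s) ^ K" using s by (intro H) auto
    moreover have "C * (1 + norm s) ^ K \<le> C' * (1 + norm s) ^ K"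
      by (intro mult_right_mono) (auto simp: C'_def)
    ultimately have "norm (H s) \<le> C' * (E * ?t) ^ K" by linarith
    hence "norm (Gamma s * H s) \<le> (G / ?t ^ (K + 2)) * (C' * (E * ?t) ^ K)"
      unfolding norm_mult using s G by (intro mult_mono G(2)) auto
    also have "\<dots> = G * C' * E ^ K / (Im s)\<^sup>2"
      using t by (simp add: power_add power_mult_distrib power2_eq_square field_simps)
    \<comment> \<open>Since |Im s| \<ge> 1, the square of Im s is at least half of 1 + (Im s)^2;
      this is the factor 2 in the final constant.\<close>
    also have "\<dots> \<le> G * C' * E ^ K / ((1 + (Im s)\<^sup>2) / 2)"
    proof (rule divide_left_mono)
      have "1 \<le> (Im s)\<^sup>2" using t by (metis one_le_power power2_abs)
      thus "(1 + (Im s)\<^sup>2) / 2 \<le> (Im s)\<^sup>2" "0 < (Im s)\<^sup>2 * ((1 + (Im s)\<^sup>2) / 2)"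
        by (auto intro!: mult_pos_pos simp: add_pos_pos)
      show "0 \<le> G * C' * E ^ K" using G by (auto simp: C'_def E_def)
    qed
    finally show ?thesis by (simp add: mult_ac)
  qed
  moreover have "2 * G * C' * E ^ K \<ge> 0" using G by (auto simp: C'_def E_def)
  ultimately show ?thesis using that by blast
qed

lemma norm_divide_powr:
  "x > 0 \<Longrightarrow> norm (z / of_real x powr s) = norm z * x powr (- Re s)"
  by (simp add: norm_divide norm_powr_real_powr powr_minus_divide)

lemma Gamma_times_poly_divide_powr_decay:
  assumes H: "\<And>s. A \<le> Re s \<Longrightarrow> Re s \<le> B \<Longrightarrow> \<bar>Im s\<bar> \<ge> T \<Longrightarrow> norm (H s) \<le> C * (1 + norm s) ^ K"
    and x: "x > 0"
  obtains D T' where "\<And>s. A \<le> Re s \<Longrightarrow> Re s \<le> B \<Longrightarrow> \<bar>Im s\<bar> \<ge> T' \<Longrightarrow>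
                          norm (Gamma s * H s / of_real x powr s) \<le> D / (1 + (Im s)\<^sup>2)"
proof -
  obtain D T' where D: "D \<ge> 0" "\<And>s. A \<le> Re s \<Longrightarrow> Re s \<le> B \<Longrightarrow> \<bar>Im s\<bar> \<ge> T' \<Longrightarrow>
                          norm (Gamma s * H s) \<le> D / (1 + (Im s)\<^sup>2)"
    using Gamma_times_poly_decay[OF H] by blast
  have "norm (Gamma s * H s / of_real x powr s) \<le> (D * (x powr (-A) + x powr (-B))) / (1 + (Im s)\<^sup>2)"
    if s: "A \<le> Re s" "Re s \<le> B" "\<bar>Im s\<bar> \<ge> T'" for s
  proof -
    \<comment> \<open>The left side is monotone in Re s, so one end of the strip dominates. Which
      one depends on whether x \<ge> 1; the sum covers both.\<close>
    have "x powr (- Re s) \<le> x powr (-A) + x powr (-B)"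
    proof (cases "x \<ge> 1")
      case True
      hence "x powr (- Re s) \<le> x powr (-A)" using s by (intro powr_mono) auto
      thus ?thesis by (simp add: add_increasing2)
    next
      case False
      hence "x powr (- Re s) \<le> x powr (-B)" using s x by (intro powr_mono') auto
      thus ?thesis by (simp add: add_increasing)
    qed
    hence "norm (Gamma s * H s / of_real x powr s) \<le> D / (1 + (Im s)\<^sup>2) * (x powr (-A) + x powr (-B))"
      unfolding norm_divide_powr[OF x] using D s by (intro mult_mono D) (auto intro: add_nonneg_nonneg)
    thus ?thesis by (simp add: mult_ac)
  qed
  thus ?thesis using that by blast
qed

subsection \<open>Mellin inversion for the exponential\<close>

lemma residue_Gamma_times:
  assumes S: "open S" "- of_nat n \<in> S" and h: "h holomorphic_on S"
  shows "residue (\<lambda>s. Gamma s * h s) (- of_nat n) = (-1) ^ n / fact n * h (- of_nat n)"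
proof (rule residue_simple')
  \<comment> \<open>All other poles of \<Gamma> are cut out, so that \<open>- of_nat n\<close> is
    the only singularity left.\<close>
  let ?S = "S \<inter> - (\<int>\<^sub>\<le>\<^sub>0 - {- of_nat n})"
  have "closed (\<int>\<^sub>\<le>\<^sub>0 - {- of_nat n} :: complex set)"
    by (intro closed_subset_Ints) auto
  thus "open ?S" using S by (intro open_Int open_Compl)
  show "- of_nat n \<in> ?S" using S by auto
  show "(\<lambda>s. Gamma s * h s) holomorphic_on ?S - {- of_nat n}"
    by (intro holomorphic_intros holomorphic_on_subset[OF h]) auto
  have "(h \<longlongrightarrow> h (- of_nat n)) (at (- of_nat n))"
    using h S by (metis holomorphic_on_imp_continuous_on continuous_on_eq_continuous_at isContD)
  hence "((\<lambda>w. (Gamma w * (w + of_nat n)) * h w) \<longlongrightarrow> (-1) ^ n / fact n * h (- of_nat n)) (at (- of_nat n))"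
    by (intro tendsto_mult Gamma_residues)
  thus "((\<lambda>w. Gamma w * h w * (w - - of_nat n)) \<longlongrightarrow> (-1) ^ n / fact n * h (- of_nat n)) (at (- of_nat n))"
    by (simp add: mult_ac)
qed

lemma Gamma_holomorphic_right_half_plane:
  "Gamma holomorphic_on {s. Re s > - real (Suc N)} - (\<lambda>n. - of_nat n) ` {..N}"
proof (rule holomorphic_Gamma)
  have "n \<le> N" if "Re (- of_nat n :: complex) > - real (Suc N)" for n :: nat
    using that by simp
  thus "({s. Re s > - real (Suc N)} - (\<lambda>n. - of_nat n) ` {..N}) \<inter> \<int>\<^sub>\<le>\<^sub>0 = {}"
    by (auto elim!: nonpos_Ints_cases')
qed

text \<open>On this line the factors s + N, s + N - 1, ..., s have real parts of modulus 1/2, 3/2,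
  ..., N + 1/2; bounding these below by 1/2, 1, ..., N gives the factorial. It is what makes the
  integrals over lines further and further left tend to 0.\<close>

lemma norm_pochhammer_half_ge:
  assumes "Re s = - real N - 1/2"
  shows "norm (pochhammer s (Suc N)) \<ge> fact N / 2"
proof -
  have "norm (pochhammer s (Suc N)) = (\<Prod>i=0..N. norm (s + of_nat i))"
    by (simp add: pochhammer_prod prod_norm atLeastLessThanSuc_atLeastAtMost)
  also have "\<dots> = (\<Prod>i=0..N. norm (s + of_nat (N - i)))"
    by (subst prod.atLeastAtMost_rev) simp
  finally have eq: "norm (pochhammer s (Suc N)) = (\<Prod>i=0..N. norm (s + of_nat (N - i)))" .
  have "(fact N / 2 :: real) = (\<Prod>i=0..N. if i = 0 then 1/2 else real i)"
    by (simp add: prod.atLeast_Suc_atMost fact_prod) 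
  also have "\<dots> \<le> (\<Prod>i=0..N. norm (s + of_nat (N - i)))"
  proof (rule prod_mono)
    fix i assume "i \<in> {0..N}"
    hence "\<bar>Re (s + of_nat (N - i))\<bar> = real i + 1/2" using assms by (auto simp: of_nat_diff)
    hence "norm (s + of_nat (N - i)) \<ge> real i + 1/2" using abs_Re_le_cmod by metis
    thus "0 \<le> (if i = 0 then 1/2 else real i) \<and>
         (if i = 0 then 1/2 else real i) \<le> norm (s + of_nat (N - i))" by auto
  qed
  finally show ?thesis by (simp add: eq)
qed

lemma vertical_line_integrable_Gamma: "c > 0 \<Longrightarrow> vertical_line_integrable c Gamma"
proof -
  assume c: "c > 0"
  obtain D T' where D: "\<And>s. c \<le> Re s \<Longrightarrow> Re s \<le> c \<Longrightarrow> \<bar>Im s\<bar> \<ge> T' \<Longrightarrow>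
                          norm (Gamma s * 1) \<le> D / (1 + (Im s)\<^sup>2)"
    by (rule Gamma_times_poly_decay[of c c 0 "\<lambda>_. 1" 1 0]) auto
  show ?thesis
  proof (rule vertical_line_integrableI)
    show "continuous_on {s. Re s = c} (Gamma :: complex \<Rightarrow> complex)"
      using c by (intro continuous_on_Gamma) (auto elim!: nonpos_Ints_cases)
  qed (use D in auto)
qed

text \<open>Applying the functional equation N + 1 times leads back to the line Re s = 1/2 whatever
  N is, so N enters the bound only through y^N / N!.\<close>

lemma Gamma_left_shift_bound:
  assumes y: "y > 0"
  shows "norm (vertical_line_integral (- real N - 1/2) (\<lambda>s. Gamma s / of_real y powr s)) \<le>
           2 * y powr (1/2) * (LINT t|lborel. norm (Gamma (Complex (1/2) t))) * (y ^ N / fact N)"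
proof -
  let ?F = "\<lambda>s. Gamma s / of_real y powr s"
  have bound: "norm (?F (Complex (- real N - 1/2) t)) \<le>
      norm (Gamma (Complex (1/2) t)) * (2 * y powr (1/2) * (y ^ N / fact N))" for t
  proof -
    define s where "s = Complex (- real N - 1/2) t"
    have "s \<notin> \<int>\<^sub>\<le>\<^sub>0"
    proof
      assume "s \<in> \<int>\<^sub>\<le>\<^sub>0"
      then obtain k where "s = - of_nat k" by (elim nonpos_Ints_cases')
      hence "Re s = - real k" by simp
      hence "real (2 * k) = real (2 * N + 1)" by (simp add: s_def)
      hence "2 * k = 2 * N + 1" by (simp only: of_nat_eq_iff)
      thus False by presburger
    qed
    hence "Gamma s \<noteq> 0" "pochhammer s (Suc N) = Gamma (s + of_nat (Suc N)) / Gamma s"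
      by (auto simp: Gamma_eq_zero_iff pochhammer_Gamma)
    moreover have "s + of_nat (Suc N) = Complex (1/2) t"
      by (simp add: s_def complex_eq_iff)
    ultimately have "norm (Gamma s) * norm (pochhammer s (Suc N)) = norm (Gamma (Complex (1/2) t))"
      by (simp add: norm_divide)
    moreover have "norm (Gamma s) * (fact N / 2) \<le> norm (Gamma s) * norm (pochhammer s (Suc N))"
      by (intro mult_left_mono norm_pochhammer_half_ge) (auto simp: s_def)
    ultimately have "norm (Gamma s) \<le> norm (Gamma (Complex (1/2) t)) * (2 / fact N)"
      by (simp add: field_simps)
    hence "norm (?F s) \<le> norm (Gamma (Complex (1/2) t)) * (2 / fact N) * y powr (- Re s)"
      unfolding norm_divide_powr[OF y] by (intro mult_right_mono) auto
    also have "y powr (- Re s) = y ^ N * y powr (1/2)"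
      using y by (simp add: s_def powr_add powr_realpow)
    finally show ?thesis by (simp add: s_def mult_ac)
  qed
  have int: "integrable lborel (\<lambda>t. norm (Gamma (Complex (1/2) t)) * (2 * y powr (1/2) * (y ^ N / fact N)))"
    using vertical_line_integrable_Gamma[of "1/2"]
    by (intro integrable_mult_left integrable_norm) (auto simp: vertical_line_integrable_def)
  have "norm (vertical_line_integral (- real N - 1/2) ?F) =
          norm (LINT t|lborel. ?F (Complex (- real N - 1/2) t))"
    by (simp add: vertical_line_integral_def norm_mult)
  also have "\<dots> \<le> (LINT t|lborel. norm (?F (Complex (- real N - 1/2) t)))"
    by (rule integral_norm_bound)
  also have "\<dots> \<le> (LINT t|lborel. norm (Gamma (Complex (1/2) t)) * (2 * y powr (1/2) * (y ^ N / fact N)))"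
    using y by (intro integral_mono'[OF int bound]) auto
  also have "\<dots> = 2 * y powr (1/2) * (LINT t|lborel. norm (Gamma (Complex (1/2) t))) * (y ^ N / fact N)"
    by (simp add: mult_ac)
  finally show ?thesis .
qed

text \<open>Moving the line of integration to the far left collects the exponential series as residues.\<close>

lemma Gamma_mellin_inversion:
  assumes c: "c > 0" and y: "y > 0"
  shows "vertical_line_integrable c (\<lambda>s. Gamma s / of_real y powr s)"
    and "vertical_line_integral c (\<lambda>s. Gamma s / of_real y powr s) =
           2 * of_real pi * \<i> * exp (- of_real y)"
proof -
  let ?F = "\<lambda>s. Gamma s / of_real y powr s"
  have shift: "vertical_line_integrable c ?F \<and>
      vertical_line_integral c ?F = vertical_line_integral (- real N - 1/2) ?F +
         2 * of_real pi * \<i> * (\<Sum>n\<le>N. (- of_real y) ^ n / fact n)" for N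
  proof -
    let ?P = "(\<lambda>n. - of_nat n :: complex) ` {..N}"
    obtain D T' where D: "\<And>s. - real N - 1/2 \<le> Re s \<Longrightarrow> Re s \<le> c \<Longrightarrow> \<bar>Im s\<bar> \<ge> T' \<Longrightarrow>
                          norm (Gamma s * 1 / of_real y powr s) \<le> D / (1 + (Im s)\<^sup>2)"
      by (rule Gamma_times_poly_divide_powr_decay[of "- real N - 1/2" c 0 "\<lambda>_. 1" 1 0 y]) (use y in auto)
    have hol: "?F holomorphic_on {s. Re s > - real (Suc N)} - ?P"
      using y by (intro holomorphic_intros Gamma_holomorphic_right_half_plane) auto
    have res: "residue ?F (- of_nat n) = (- of_real y) ^ n / fact n" for n
    proof -
      have "residue (\<lambda>s. Gamma s * (1 / of_real y powr s)) (- of_nat n) =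
              (-1) ^ n / fact n * (1 / of_real y powr (- of_nat n))"
        by (rule residue_Gamma_times[of UNIV]) (use y in \<open>auto intro!: holomorphic_intros\<close>)
      also have "\<dots> = (- of_real y) ^ n / fact n"
        using y by (simp add: powr_minus powr_nat' power_minus[of "of_real y"] divide_inverse)
      finally show ?thesis by simp
    qed
    have "vertical_line_integral c ?F = vertical_line_integral (- real N - 1/2) ?F +
            2 * of_real pi * \<i> * (\<Sum>p\<in>?P. residue ?F p)"
      by (rule vertical_line_integral_shift(3)[of "- real (Suc N)" _ _ ?P ?F T' D])
         (use hol D c in auto)
    moreover have "vertical_line_integrable c ?F"
      by (rule vertical_line_integral_shift(2)[of "- real (Suc N)" "- real N - 1/2" _ ?P ?F T' D])
         (use hol D c in auto)
    moreover have "(\<Sum>p\<in>?P. residue ?F p) = (\<Sum>n\<le>N. (- of_real y) ^ n / fact n)"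
      by (subst sum.reindex) (auto simp: inj_on_def res)
    ultimately show ?thesis by simp
  qed
  show "vertical_line_integrable c ?F" using shift by blast
  define J where "J = 2 * y powr (1/2) * (LINT t|lborel. norm (Gamma (Complex (1/2) t)))"
  have "(\<lambda>N. y ^ N / fact N) \<longlonglongrightarrow> 0"
    using summable_LIMSEQ_zero[OF summable_exp[of y]] by (simp add: field_simps)
  hence "(\<lambda>N. J * (y ^ N / fact N)) \<longlonglongrightarrow> 0"
    by (rule tendsto_mult_right_zero)
  hence "(\<lambda>N. vertical_line_integral (- real N - 1/2) ?F) \<longlonglongrightarrow> 0"
    by (rule Lim_null_comparison[rotated])
       (use Gamma_left_shift_bound[OF y] in \<open>auto simp: J_def\<close>)
  moreover have "(\<lambda>N. \<Sum>n\<le>N. (- of_real y) ^ n / fact n) \<longlonglongrightarrow> exp (- of_real y :: complex)"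
    using exp_converges[of "- of_real y :: complex"]
    by (simp add: sums_def_le scaleR_conv_of_real field_simps)
  ultimately have "(\<lambda>N. vertical_line_integral (- real N - 1/2) ?F +
         2 * of_real pi * \<i> * (\<Sum>n\<le>N. (- of_real y) ^ n / fact n)) \<longlonglongrightarrow>
         0 + 2 * of_real pi * \<i> * exp (- of_real y)"
    by (intro tendsto_intros)
  moreover have "(\<lambda>N. vertical_line_integral (- real N - 1/2) ?F +
         2 * of_real pi * \<i> * (\<Sum>n\<le>N. (- of_real y) ^ n / fact n)) =
         (\<lambda>N. vertical_line_integral c ?F)"
    using shift by auto
  ultimately have "(\<lambda>N::nat. vertical_line_integral c ?F) \<longlonglongrightarrow> 2 * of_real pi * \<i> * exp (- of_real y)"
    by simp
  thus "vertical_line_integral c ?F = 2 * of_real pi * \<i> * exp (- of_real y)"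
    by (simp add: LIMSEQ_const_iff)
qed

subsection \<open>The Dirichlet series of the divisor function\<close>

text \<open>For complex families unconditional and absolute summability coincide, which yields
  summability on the product; the value is then found by summing over \<open>B\<close>
  first.\<close>

lemma has_sum_times:
  fixes f g :: "'a \<Rightarrow> complex"
  assumes f: "(f has_sum u) A" and g: "(g has_sum v) B"
  shows "((\<lambda>(x, y). f x * g y) has_sum (u * v)) (A \<times> B)"
proof -
  have absf: "(\<lambda>x. norm (f x)) summable_on A" and absg: "(\<lambda>x. norm (g x)) summable_on B"
    using f g by (auto simp: summable_on_iff_abs_summable_on_complex[symmetric] intro: has_sum_imp_summable)
  have "(\<lambda>p. norm (case p of (x, y) \<Rightarrow> f x * g y)) summable_on (A \<times> B)"
  proof (subst Infinite_Sum.abs_summable_on_Sigma_iff, intro conjI ballI)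
    show "(\<lambda>y. norm (case (x, y) of (x, y) \<Rightarrow> f x * g y)) summable_on B" for x
      using absg by (simp add: norm_mult summable_on_cmult_right)
    have "(\<lambda>x. norm (f x) * (\<Sum>\<^sub>\<infinity>y\<in>B. norm (g y))) summable_on A"
      using absf by (rule summable_on_cmult_left)
    moreover have "(\<Sum>\<^sub>\<infinity>y\<in>B. norm (g y)) \<ge> 0" by (intro infsum_nonneg) auto
    ultimately show "(\<lambda>x. norm (\<Sum>\<^sub>\<infinity>y\<in>B. norm (case (x, y) of (x, y) \<Rightarrow> f x * g y))) summable_on A"
      by (simp add: norm_mult infsum_cmult_right' abs_mult)
  qed
  hence "(\<lambda>(x, y). f x * g y) summable_on (A \<times> B)"
    by (rule Infinite_Sum.abs_summable_summable)
  then obtain S where S: "((\<lambda>(x, y). f x * g y) has_sum S) (A \<times> B)"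
    by (auto simp: summable_on_def)
  have "((\<lambda>x. f x * v) has_sum S) A"
    by (rule has_sum_Sigma'[OF S]) (auto intro!: has_sum_cmult_right g)
  moreover have "((\<lambda>x. f x * v) has_sum (u * v)) A" by (intro has_sum_cmult_left f)
  ultimately show ?thesis using S has_sum_unique by blast
qed

lemma has_sum_dzeta:
  assumes "Re s > 1"
  shows "((\<lambda>n. of_nat n powr (- s)) has_sum dzeta s) {0<..}"
proof -
  have "summable (\<lambda>n. norm (1 / of_nat (Suc n) powr s :: complex))"
    unfolding norm_inverse_Suc_powr using assms by (rule summable_Suc_powr)
  moreover have "(\<lambda>n. 1 / of_nat (Suc n) powr s) sums dzeta s"
    unfolding dzeta_def using assms by (intro summable_sums summable_dzeta)
  ultimately have "((\<lambda>n. 1 / of_nat (Suc n) powr s) has_sum dzeta s) UNIV"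
    by (rule norm_summable_imp_has_sum)
  moreover have "bij_betw Suc UNIV {0<..}"
    by (auto simp: bij_betw_def greaterThan_0)
  ultimately show ?thesis
    using has_sum_reindex_bij_betw[of Suc UNIV "{0<..}" "\<lambda>n. of_nat n powr (- s)" "dzeta s"]
    by (simp add: powr_minus_divide del: of_nat_Suc)
qed

lemma powr_of_nat_mult:
  "of_nat (m * n) powr s = of_nat m powr s * (of_nat n powr s :: complex)"
  using powr_times_real[of "of_nat m" "of_nat n" s] by simp

text \<open>Sort the pairs (d, k) in the product of the two Dirichlet series by n = d k; the fibre
  over n is the set of divisors of n. The power of d with exponent \<alpha> is left over because d
  carries the exponent w - \<alpha> instead of w.\<close>

lemma has_sum_divisor_sigma:
  assumes w: "Re w > 1" "Re (w - \<alpha>) > 1"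
  shows "((\<lambda>n. divisor_sigma \<alpha> n / of_nat n powr w) has_sum (dzeta w * dzeta (w - \<alpha>))) {0<..}"
proof -
  define f where "f = (\<lambda>d k. of_nat d powr (- (w - \<alpha>)) * of_nat k powr (- w) :: complex)"
  have "((\<lambda>(d, k). f d k) has_sum (dzeta (w - \<alpha>) * dzeta w)) ({0<..} \<times> {0<..})"
    unfolding f_def by (intro has_sum_times has_sum_dzeta w)
  also have "?this \<longleftrightarrow> ((\<lambda>(n, d). f d (n div d)) has_sum (dzeta w * dzeta (w - \<alpha>)))
                (SIGMA n:{0<..}. {d. d dvd n})"
    by (rule has_sum_reindex_bij_witness[of _ "\<lambda>(n, d). (d, n div d)" "\<lambda>(d, k). (d * k, d)"])
       (auto elim!: dvdE simp: mult.commute)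
  finally have S: "((\<lambda>(n, d). f d (n div d)) has_sum (dzeta w * dzeta (w - \<alpha>)))
                (SIGMA n:{0<..}. {d. d dvd n})" .
  show ?thesis
  proof (rule has_sum_Sigma'[OF S])
    fix n :: nat assume n: "n \<in> {0<..}"
    have "f d (n div d) = of_nat d powr \<alpha> / of_nat n powr w" if "d dvd n" for d
    proof -
      from that obtain k where k: "n = d * k" by (elim dvdE)
      hence "d > 0" using n by auto
      have "f d (n div d) = of_nat d powr (\<alpha> + - w) * of_nat k powr (- w)"
        using \<open>d > 0\<close> by (simp add: f_def k)
      also have "\<dots> = of_nat d powr \<alpha> * of_nat n powr (- w)"
        by (simp only: powr_add k powr_of_nat_mult mult.assoc)
      finally show ?thesis by (simp add: powr_minus_divide)
    qed
    hence "divisor_sigma \<alpha> n / of_nat n powr w = (\<Sum>d | d dvd n. f d (n div d))"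
      by (simp add: divisor_sigma_def sum_divide_distrib)
    thus "((\<lambda>d. case (n, d) of (n, d) \<Rightarrow> f d (n div d)) has_sum (divisor_sigma \<alpha> n / of_nat n powr w)) {d. d dvd n}"
      using n by (intro has_sum_finiteI) auto
  qed
qed

lemma divisor_sigma_sums:
  assumes w: "Re w > 1" "Re (w - \<alpha>) > 1"
  shows "(\<lambda>n. divisor_sigma \<alpha> (Suc n) / of_nat (Suc n) powr w) sums (dzeta w * dzeta (w - \<alpha>))"
    and "summable (\<lambda>n. norm (divisor_sigma \<alpha> (Suc n) / of_nat (Suc n) powr w))"
proof -
  have "bij_betw Suc UNIV {0<..}"
    by (auto simp: bij_betw_def greaterThan_0)
  hence *: "((\<lambda>n. divisor_sigma \<alpha> (Suc n) / of_nat (Suc n) powr w) has_sum (dzeta w * dzeta (w - \<alpha>))) UNIV"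
    using has_sum_divisor_sigma[OF w]
    by (rule has_sum_reindex_bij_betw[of Suc UNIV "{0<..}"
          "\<lambda>n. divisor_sigma \<alpha> n / of_nat n powr w", THEN iffD2])
  show "(\<lambda>n. divisor_sigma \<alpha> (Suc n) / of_nat (Suc n) powr w) sums (dzeta w * dzeta (w - \<alpha>))"
    using * by (rule has_sum_imp_sums)
  have "(\<lambda>n. norm (divisor_sigma \<alpha> (Suc n) / of_nat (Suc n) powr w)) summable_on UNIV"
    using has_sum_imp_summable[OF *] by (simp only: summable_on_iff_abs_summable_on_complex)
  thus "summable (\<lambda>n. norm (divisor_sigma \<alpha> (Suc n) / of_nat (Suc n) powr w))"
    by (rule summable_on_imp_summable)
qed

lemma of_real_powr_powr:
  fixes n :: nat and s :: complex
  assumes "n > 0" "x > 0"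
  shows "of_real (real n powr a * x) powr s = of_nat n powr (of_real a * s) * of_real x powr s"
proof -
  have *: "of_real r powr s = exp (s * of_real (ln r))" if "r > 0" for r
    using that by (simp add: powr_def Ln_of_real)
  have "real n powr a * x > 0" using assms by simp
  hence "of_real (real n powr a * x) powr s = exp (s * of_real (ln (real n powr a * x)))"
    by (rule *)
  also have "ln (real n powr a * x) = a * ln (real n) + ln x"
    using assms by (simp add: ln_mult ln_powr)
  also have "exp (s * of_real (a * ln (real n) + ln x)) =
      exp (of_real a * s * of_real (ln (real n))) * exp (s * of_real (ln x))"
    by (simp add: exp_add[symmetric] algebra_simps)
  also have "exp (s * of_real (ln x)) = of_real x powr s" using * assms by simp
  also have "exp (of_real a * s * of_real (ln (real n))) = of_nat n powr (of_real a * s)"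
    using assms Ln_of_real[of "real n"] by (simp add: powr_def)
  finally show ?thesis .
qed

text \<open>Sum and integral may be interchanged because on the line the modulus of the n-th
  integrand splits into a factor in n and a factor in t: the modulus of n^(-w) depends on Re w
  alone. The integrated norms therefore sum to a convergent Dirichlet series times one integral of
  |\<Gamma>|.\<close>

theorem sigma_exp_sum_mellin:
  assumes x: "x > 0" and c: "c > 0" and a: "a > 0" and ca: "a * c + Re b > 1" "a * c + Re (b - \<alpha>) > 1"
  defines "F \<equiv> (\<lambda>s. Gamma s * zeta (of_real a * s + b) * zeta (of_real a * s + b - \<alpha>) / of_real x powr s)"
  shows "summable (\<lambda>n. sigma_exp_term \<alpha> a b x (Suc n))"
    and "vertical_line_integrable c F"
    and "vertical_line_integral c F = 2 * of_real pi * \<i> * sigma_exp_sum \<alpha> a b x"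
proof -
  define C where "C = (\<lambda>n. divisor_sigma \<alpha> (Suc n) / of_nat (Suc n) powr b)"
  define y where "y = (\<lambda>n. real (Suc n) powr a * x)"
  have y: "y n > 0" for n using x by (simp add: y_def)
  define f where "f = (\<lambda>n t. C n * (Gamma (Complex c t) / of_real (y n) powr (Complex c t)))"
  define w where "w = (\<lambda>t. of_real a * Complex c t + b)"
  have w: "Re (w t) > 1" "Re (w t - \<alpha>) > 1" for t using ca by (simp_all add: w_def)
  have f_eq: "f n t = Gamma (Complex c t) / of_real x powr (Complex c t) *
               (divisor_sigma \<alpha> (Suc n) / of_nat (Suc n) powr w t)" for n t
  proof -
    have "of_real (y n) powr (Complex c t) =
            of_nat (Suc n) powr (of_real a * Complex c t) * of_real x powr (Complex c t)"
      unfolding y_def using x by (intro of_real_powr_powr) auto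
    thus ?thesis by (simp add: f_def C_def w_def powr_add mult_ac del: of_nat_Suc)
  qed
  have f_sums: "(\<lambda>n. f n t) sums F (Complex c t)" for t
  proof -
    have "(\<lambda>n. f n t) sums (Gamma (Complex c t) / of_real x powr (Complex c t) * (dzeta (w t) * dzeta (w t - \<alpha>)))"
      unfolding f_eq by (intro sums_mult divisor_sigma_sums w)
    moreover have "dzeta (w t) = zeta (w t)" "dzeta (w t - \<alpha>) = zeta (w t - \<alpha>)"
      using w[of t] by (simp_all add: zeta_eq_dzeta)
    ultimately show ?thesis by (simp add: F_def w_def mult_ac)
  qed
  have norm_f: "norm (f n t) = x powr (-c) * norm (divisor_sigma \<alpha> (Suc n) / of_nat (Suc n) powr w 0) *
                      norm (Gamma (Complex c t))" for n t
  proof -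
    have "norm (of_nat (Suc n) powr w t) = norm (of_nat (Suc n) powr w 0 :: complex)"
      by (simp add: norm_powr_real_powr w_def del: of_nat_Suc)
    hence "norm (divisor_sigma \<alpha> (Suc n) / of_nat (Suc n) powr w t) =
             norm (divisor_sigma \<alpha> (Suc n) / of_nat (Suc n) powr w 0)"
      by (simp only: norm_divide)
    moreover have "norm (Gamma (Complex c t) / of_real x powr (Complex c t)) =
                     norm (Gamma (Complex c t)) * x powr (-c)"
      using norm_divide_powr[OF x, of _ "Complex c t"] by simp
    ultimately show ?thesis unfolding f_eq norm_mult by (simp only: mult_ac)
  qed
  have f_summable: "summable (\<lambda>n. norm (f n t))" for t
    unfolding norm_f by (intro summable_mult summable_mult2 divisor_sigma_sums w)
  have f_int: "integrable lborel (f n)" for n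
    using Gamma_mellin_inversion(1)[OF c y, of n]
    unfolding f_def vertical_line_integrable_def by (rule integrable_mult_right)
  have f_int_summable: "summable (\<lambda>n. LINT t|lborel. norm (f n t))"
    unfolding norm_f integral_mult_right_zero
    by (intro summable_mult summable_mult2 divisor_sigma_sums w)
  note * = f_int always_eventually[OF allI, OF f_summable] f_int_summable
  have F_eq: "(\<Sum>n. f n t) = F (Complex c t)" for t using f_sums[of t] by (simp add: sums_iff)
  show "vertical_line_integrable c F"
    using integrable_suminf[OF *] by (simp add: F_eq vertical_line_integrable_def)
  have "(\<lambda>n. LINT t|lborel. f n t) sums (LINT t|lborel. F (Complex c t))"
    using sums_integral[OF *] by (simp add: F_eq)
  moreover have "(LINT t|lborel. f n t) = 2 * of_real pi * sigma_exp_term \<alpha> a b x (Suc n)" for n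
  proof -
    have "\<i> * (LINT t|lborel. f n t) = C n * vertical_line_integral c (\<lambda>s. Gamma s / of_real (y n) powr s)"
      by (simp only: f_def vertical_line_integral_def integral_mult_right_zero mult.left_commute)
    also have "\<dots> = \<i> * (2 * of_real pi * (C n * exp (- of_real (y n))))"
      by (simp add: Gamma_mellin_inversion(2)[OF c y])
    also have "C n * exp (- of_real (y n)) = sigma_exp_term \<alpha> a b x (Suc n)"
      by (simp add: sigma_exp_term_def C_def y_def exp_of_real[symmetric] del: of_nat_Suc)
    finally show ?thesis by simp
  qed
  ultimately have S: "(\<lambda>n. 2 * of_real pi * sigma_exp_term \<alpha> a b x (Suc n)) sums (LINT t|lborel. F (Complex c t))"
    by simp
  hence "summable (\<lambda>n. 2 * of_real pi * sigma_exp_term \<alpha> a b x (Suc n))" by (rule sums_summable)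
  thus summ: "summable (\<lambda>n. sigma_exp_term \<alpha> a b x (Suc n))" by (simp add: summable_cmult_iff)
  have "(LINT t|lborel. F (Complex c t)) = 2 * of_real pi * sigma_exp_sum \<alpha> a b x"
    using S summ by (simp add: sums_iff sigma_exp_sum_def suminf_mult)
  thus "vertical_line_integral c F = 2 * of_real pi * \<i> * sigma_exp_sum \<alpha> a b x"
    by (simp add: vertical_line_integral_def)
qed

subsection \<open>The asymptotic expansion in terms of residues\<close>

lemma zeta_affine_bound:
  assumes a: "a > 0"
  obtains C K T where "C \<ge> 0" "\<And>s. Re s \<ge> A \<Longrightarrow> \<bar>Im s\<bar> \<ge> T \<Longrightarrow>
                         norm (zeta (of_real a * s + u)) \<le> C * (1 + norm s) ^ K"
proof -
  have "a * A + Re u - 1 < a * A + Re u" by simp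
  from half_plane_polyE[OF half_plane_poly_zeta_reg this]
  obtain C K where C: "C \<ge> 0" "\<And>w. Re w \<ge> a * A + Re u \<Longrightarrow> norm (zeta_reg w) \<le> C * (1 + norm w) ^ K"
    by blast
  \<comment> \<open>Above this height |Im (a s + u)| \<ge> 1, which keeps the argument away from the
    pole at 1, so dividing \<open>zeta_reg\<close> by w - 1 does not spoil its bound.\<close>
  define T where "T = (1 + \<bar>Im u\<bar>) / a"
  have "norm (zeta (of_real a * s + u)) \<le> (C * (1 + a + norm u) ^ K) * (1 + norm s) ^ K"
    if s: "Re s \<ge> A" "\<bar>Im s\<bar> \<ge> T" for s
  proof -
    define w where "w = of_real a * s + u"
    have "1 + \<bar>Im u\<bar> \<le> a * \<bar>Im s\<bar>" using s(2) a by (simp add: T_def field_simps)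
    also have "a * \<bar>Im s\<bar> = \<bar>a * Im s\<bar>" using a by (simp add: abs_mult)
    finally have "\<bar>Im (w - 1)\<bar> \<ge> 1" by (simp add: w_def)
    hence nw: "norm (w - 1) \<ge> 1" using abs_Im_le_cmod[of "w - 1"] by linarith
    hence "norm (zeta w) = norm (zeta_reg w) / norm (w - 1)"
      by (subst zeta_eq_zeta_reg) (auto simp: norm_divide)
    also have "\<dots> \<le> norm (zeta_reg w)" using nw by (simp add: divide_le_eq mult_le_cancel_left1)
    also have "\<dots> \<le> C * (1 + norm w) ^ K"
      using s a by (intro C) (auto simp: w_def)
    also have "1 + norm w \<le> (1 + a + norm u) * (1 + norm s)"
    proof -
      have "norm w \<le> a * norm s + norm u"
        unfolding w_def by (rule order_trans[OF norm_triangle_ineq]) (use a in \<open>simp add: norm_mult\<close>)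
      moreover have "norm u * norm s \<ge> 0" by simp
      ultimately show ?thesis using a norm_ge_zero[of s] unfolding distrib_left distrib_right by linarith
    qed
    hence "C * (1 + norm w) ^ K \<le> C * ((1 + a + norm u) * (1 + norm s)) ^ K"
      using C(1) by (intro mult_left_mono power_mono) auto
    finally show ?thesis by (simp add: w_def power_mult_distrib mult_ac)
  qed
  moreover have "C * (1 + a + norm u) ^ K \<ge> 0" using C(1) a by simp
  ultimately show ?thesis using that by blast
qed

lemma zeta_affine_product_bound:
  assumes a: "a > 0"
  obtains C K T where "\<And>s. Re s \<ge> A \<Longrightarrow> \<bar>Im s\<bar> \<ge> T \<Longrightarrow>
     norm (zeta (of_real a * s + u) * zeta (of_real a * s + v)) \<le> C * (1 + norm s) ^ K"
proof -
  obtain C K T where 1: "C \<ge> 0" "\<And>s. Re s \<ge> A \<Longrightarrow> \<bar>Im s\<bar> \<ge> T \<Longrightarrow>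
                         norm (zeta (of_real a * s + u)) \<le> C * (1 + norm s) ^ K"
    using zeta_affine_bound[OF a, of A u] by metis
  obtain D L U where 2: "D \<ge> 0" "\<And>s. Re s \<ge> A \<Longrightarrow> \<bar>Im s\<bar> \<ge> U \<Longrightarrow>
                         norm (zeta (of_real a * s + v)) \<le> D * (1 + norm s) ^ L"
    using zeta_affine_bound[OF a, of A v] by metis
  have "norm (zeta (of_real a * s + u) * zeta (of_real a * s + v)) \<le> (C * D) * (1 + norm s) ^ (K + L)"
    if "Re s \<ge> A" "\<bar>Im s\<bar> \<ge> max T U" for s
  proof -
    have "norm (zeta (of_real a * s + u) * zeta (of_real a * s + v)) \<le>
            (C * (1 + norm s) ^ K) * (D * (1 + norm s) ^ L)"
      unfolding norm_mult using that 1 2 by (intro mult_mono) auto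
    thus ?thesis by (simp add: power_add mult_ac)
  qed
  thus ?thesis using that by blast
qed

text \<open>In the application u = b and v = b - \<alpha>. The symmetry in u and v lets a residue
  computed at the pole of the first zeta factor serve for the second one as well.\<close>

definition mellin_integrand :: "real \<Rightarrow> complex \<Rightarrow> complex \<Rightarrow> real \<Rightarrow> complex \<Rightarrow> complex" where
  "mellin_integrand a u v x s =
     Gamma s * zeta (of_real a * s + u) * zeta (of_real a * s + v) / of_real x powr s"

lemma mellin_integrand_commute: "mellin_integrand a u v = mellin_integrand a v u"
  by (simp add: mellin_integrand_def fun_eq_iff mult_ac)

lemma affine_eq_1_iff:
  fixes s u :: complex
  shows "a > 0 \<Longrightarrow> of_real a * s + u = 1 \<longleftrightarrow> s = (1 - u) / of_real a"
  by (auto simp: field_simps)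

lemma zeta_affine_holomorphic:
  assumes a: "a > 0"
  shows "(\<lambda>s. zeta (of_real a * s + u)) holomorphic_on - {(1 - u) / of_real a}"
proof (rule holomorphic_on_compose_gen[OF _ zeta_holomorphic, unfolded o_def])
  show "(\<lambda>s. of_real a * s + u) holomorphic_on - {(1 - u) / of_real a}"
    by (intro holomorphic_intros)
  show "(\<lambda>s. of_real a * s + u) ` (- {(1 - u) / of_real a}) \<subseteq> - {1}"
  proof (rule image_subsetI)
    fix s assume "s \<in> - {(1 - u) / of_real a}"
    hence "s \<noteq> (1 - u) / of_real a" by simp
    hence "of_real a * s + u \<noteq> 1" by (simp only: affine_eq_1_iff[OF a] not_False_eq_True)
    thus "of_real a * s + u \<in> - {1}" by (simp only: Compl_iff singleton_iff not_False_eq_True)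
  qed
qed

lemma mellin_integrand_expansion:
  fixes a x :: real and b \<alpha> :: complex and M :: nat
  defines "s1 \<equiv> (1 - b) / of_real a" and "s2 \<equiv> (1 - (b - \<alpha>)) / of_real a"
  defines "F \<equiv> mellin_integrand a b (b - \<alpha>)"
  assumes a: "a > 0" and M: "Re s1 > - real M - 1/2" "Re s2 > - real M - 1/2" and x: "x > 0"
  shows "vertical_line_integrable (- real M - 1/2) (F x)"
    and "sigma_exp_sum \<alpha> a b x = vertical_line_integral (- real M - 1/2) (F x) / (2 * of_real pi * \<i>)
           + (\<Sum>p\<in>(\<lambda>n. - of_nat n) ` {..M} \<union> {s1, s2}. residue (F x) p)"
proof -
  let ?P = "(\<lambda>n. - of_nat n) ` {..M} \<union> {s1, s2}"
  \<comment> \<open>Right of 0, \<open>s1\<close> and \<open>s2\<close>, hence of all poles. Being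
    right of \<open>s1\<close> and \<open>s2\<close> means that both zeta arguments have real part
    above 1, as \<open>sigma_exp_sum_mellin\<close> requires.\<close>
  define c where "c = 1 + \<bar>Re s1\<bar> + \<bar>Re s2\<bar>"
  have c: "c > 0" "c > Re s1" "c > Re s2" by (auto simp: c_def)
  have "Re b = 1 - a * Re s1" "Re (b - \<alpha>) = 1 - a * Re s2"
    using a by (simp_all add: s1_def s2_def)
  moreover have "a * c > a * Re s1" "a * c > a * Re s2" using a c by auto
  ultimately have ca: "a * c + Re b > 1" "a * c + Re (b - \<alpha>) > 1" by linarith+
  obtain C K T where H: "\<And>s. Re s \<ge> - real M - 1/2 \<Longrightarrow> \<bar>Im s\<bar> \<ge> T \<Longrightarrow>
     norm (zeta (of_real a * s + b) * zeta (of_real a * s + (b - \<alpha>))) \<le> C * (1 + norm s) ^ K"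
    using zeta_affine_product_bound[OF a, of "- real M - 1/2" b "b - \<alpha>"] by metis
  obtain D T' where D: "\<And>s. - real M - 1/2 \<le> Re s \<Longrightarrow> Re s \<le> c \<Longrightarrow> \<bar>Im s\<bar> \<ge> T' \<Longrightarrow>
        norm (Gamma s * (zeta (of_real a * s + b) * zeta (of_real a * s + (b - \<alpha>))) / of_real x powr s)
          \<le> D / (1 + (Im s)\<^sup>2)"
    by (rule Gamma_times_poly_divide_powr_decay[OF H x, of "- real M - 1/2" c]) auto
  \<comment> \<open>The half-plane extends to the left of the line -M - 1/2 but stops at -(M + 1),
    before the next pole of \<Gamma>.\<close>
  have hol: "F x holomorphic_on {s. Re s > - real (Suc M)} - ?P"
    unfolding F_def mellin_integrand_def using x
    by (intro holomorphic_intros holomorphic_on_subset[OF Gamma_holomorphic_right_half_plane]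
              holomorphic_on_subset[OF zeta_affine_holomorphic[OF a]])
       (auto simp: s1_def s2_def)
  have P: "- real M - 1/2 < Re p \<and> Re p < c" if "p \<in> ?P" for p
    using that M c by auto
  have D': "norm (F x s) \<le> D / (1 + (Im s)\<^sup>2)"
    if "- real M - 1/2 \<le> Re s" "Re s \<le> c" "\<bar>Im s\<bar> \<ge> T'" for s
    using D[OF that] by (simp add: F_def mellin_integrand_def mult_ac)
  have fin: "finite ?P" by auto
  have lt: "- real (Suc M) < - real M - 1/2" "- real M - 1/2 < c" using c by auto
  note shift = vertical_line_integral_shift[OF lt fin P hol D']
  show "vertical_line_integrable (- real M - 1/2) (F x)" by (rule shift(1))
  have "F x = (\<lambda>s. Gamma s * zeta (of_real a * s + b) * zeta (of_real a * s + b - \<alpha>) / of_real x powr s)"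
    by (simp add: F_def mellin_integrand_def fun_eq_iff add_diff_eq)
  hence "vertical_line_integral c (F x) = 2 * of_real pi * \<i> * sigma_exp_sum \<alpha> a b x"
    using sigma_exp_sum_mellin(3)[OF x c(1) a ca] by simp
  hence "2 * of_real pi * \<i> * sigma_exp_sum \<alpha> a b x = vertical_line_integral (- real M - 1/2) (F x) +
           2 * of_real pi * \<i> * (\<Sum>p\<in>?P. residue (F x) p)"
    using shift(3) by simp
  thus "sigma_exp_sum \<alpha> a b x = vertical_line_integral (- real M - 1/2) (F x) / (2 * of_real pi * \<i>)
           + (\<Sum>p\<in>?P. residue (F x) p)"
    by (simp add: field_simps)
qed

text \<open>On the line, x enters the modulus of the integrand only through |x^(-s)| = x^(-c), so
  the integral at x = 1 provides one constant for all x.\<close>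

lemma vertical_line_integral_mellin_bound:
  assumes "x > 0" "vertical_line_integrable c (mellin_integrand a u v 1)"
  shows "norm (vertical_line_integral c (mellin_integrand a u v x)) \<le>
           (LINT t|lborel. norm (mellin_integrand a u v 1 (Complex c t))) * x powr (- c)"
proof -
  have eq: "norm (mellin_integrand a u v x (Complex c t)) =
               norm (mellin_integrand a u v 1 (Complex c t)) * x powr (- c)" for t
    unfolding mellin_integrand_def norm_divide_powr[OF assms(1)] norm_divide_powr[OF zero_less_one] by simp
  have "norm (vertical_line_integral c (mellin_integrand a u v x)) =
          norm (LINT t|lborel. mellin_integrand a u v x (Complex c t))"
    by (simp add: vertical_line_integral_def norm_mult)
  also have "\<dots> \<le> (LINT t|lborel. norm (mellin_integrand a u v x (Complex c t)))"
    by (rule integral_norm_bound)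
  also have "\<dots> = (LINT t|lborel. norm (mellin_integrand a u v 1 (Complex c t))) * x powr (- c)"
    unfolding eq by (rule integral_mult_left_zero)
  finally show ?thesis .
qed

lemma powr_smallo_power_at_right_0:
  assumes "r > real N"
  shows "(\<lambda>x. of_real (x powr r) :: complex) \<in> o[at_right 0](\<lambda>x. of_real x ^ N)"
proof (rule smalloI_tendsto)
  have "((\<lambda>x. x powr d) \<longlongrightarrow> 0) (at_right (0::real))" if "d > 0" for d :: real
    using that by real_asymp
  from tendsto_of_real[OF this[of "r - real N"]]
  have "((\<lambda>x. of_real (x powr (r - real N)) :: complex) \<longlongrightarrow> 0) (at_right 0)"
    using assms by simp
  thus "((\<lambda>x. of_real (x powr r) / of_real x ^ N :: complex) \<longlongrightarrow> 0) (at_right 0)"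
    by (rule Lim_transform_eventually)
       (auto simp: eventually_at_filter powr_diff powr_realpow)
  show "\<forall>\<^sub>F x in at_right 0. of_real x ^ N \<noteq> (0 :: complex)"
    using eventually_at_right_less[of "0::real"] by eventually_elim simp
qed

text \<open>The remainder bound is required only for arbitrarily large truncations M, not for each
  N, because the terms with N < n \<le> M are themselves o(x^N). This leaves room to choose M large
  enough to cross the zeta poles.\<close>

lemma asymp_expansion_0I:
  assumes remainder: "\<And>N. \<exists>M\<ge>N. \<exists>C. \<forall>x>0. norm (f x - (h x + (\<Sum>n | n \<in> I \<and> n \<le> M. u n x))) \<le> C * x powr (real M + 1/2)"
    and terms: "\<And>n. n \<in> I \<Longrightarrow> \<exists>C. \<forall>x>0. norm (u n x) \<le> C * x powr real n"
  shows "asymp_expansion_0 f h I u"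
  unfolding asymp_expansion_0_def
proof
  fix N
  obtain M C where M: "M \<ge> N"
    "\<And>x. x > 0 \<Longrightarrow> norm (f x - (h x + (\<Sum>n | n \<in> I \<and> n \<le> M. u n x))) \<le> C * x powr (real M + 1/2)"
    using remainder[of N] by metis
  have "(\<lambda>x. f x - (h x + (\<Sum>n | n \<in> I \<and> n \<le> M. u n x))) \<in> O[at_right 0](\<lambda>x. of_real (x powr (real M + 1/2)))"
    using M(2) by (intro bigoI[of _ C]) (auto simp: eventually_at_filter)
  also have "(\<lambda>x. of_real (x powr (real M + 1/2)) :: complex) \<in> o[at_right 0](\<lambda>x. of_real x ^ N)"
    using M(1) by (intro powr_smallo_power_at_right_0) auto
  finally have 1: "(\<lambda>x. f x - (h x + (\<Sum>n | n \<in> I \<and> n \<le> M. u n x))) \<in> o[at_right 0](\<lambda>x. of_real x ^ N)" .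
  have "u n \<in> o[at_right 0](\<lambda>x. of_real x ^ N)" if n: "n \<in> I" "n > N" for n
  proof -
    obtain C where C: "\<And>x. x > 0 \<Longrightarrow> norm (u n x) \<le> C * x powr real n" using terms[OF n(1)] by metis
    have "u n \<in> O[at_right 0](\<lambda>x. of_real (x powr real n))"
      using C by (intro bigoI[of _ C]) (auto simp: eventually_at_filter)
    also have "(\<lambda>x. of_real (x powr real n) :: complex) \<in> o[at_right 0](\<lambda>x. of_real x ^ N)"
      using n(2) by (intro powr_smallo_power_at_right_0) auto
    finally show ?thesis .
  qed
  hence 2: "(\<lambda>x. \<Sum>n | n \<in> I \<and> N < n \<and> n \<le> M. u n x) \<in> o[at_right 0](\<lambda>x. of_real x ^ N)"
    by (intro big_sum_in_smallo) auto
  have "(\<Sum>n | n \<in> I \<and> n \<le> M. u n x) =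
          (\<Sum>n | n \<in> I \<and> n \<le> N. u n x) + (\<Sum>n | n \<in> I \<and> N < n \<and> n \<le> M. u n x)" for x
  proof -
    have "{n. n \<in> I \<and> n \<le> M} = {n. n \<in> I \<and> n \<le> N} \<union> {n. n \<in> I \<and> N < n \<and> n \<le> M}"
      using M(1) by auto
    hence "(\<Sum>n | n \<in> I \<and> n \<le> M. u n x) =
             (\<Sum>n\<in>{n. n \<in> I \<and> n \<le> N} \<union> {n. n \<in> I \<and> N < n \<and> n \<le> M}. u n x)"
      by (rule arg_cong)
    also have "\<dots> = (\<Sum>n | n \<in> I \<and> n \<le> N. u n x) + (\<Sum>n | n \<in> I \<and> N < n \<and> n \<le> M. u n x)"
      by (rule sum.union_disjoint) auto
    finally show ?thesis .
  qed
  hence "(\<lambda>x. f x - (h x + (\<Sum>n | n \<in> I \<and> n \<le> N. u n x))) =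
     (\<lambda>x. (f x - (h x + (\<Sum>n | n \<in> I \<and> n \<le> M. u n x))) + (\<Sum>n | n \<in> I \<and> N < n \<and> n \<le> M. u n x))"
    by (simp add: fun_eq_iff)
  thus "(\<lambda>x. f x - (h x + (\<Sum>n | n \<in> I \<and> n \<le> N. u n x))) \<in> o[at_right 0](\<lambda>x. of_real x ^ N)"
    using sum_in_smallo(1)[OF 1 2] by simp
qed

lemma asymp_expansion_0_cong:
  assumes "asymp_expansion_0 f h I u"
    and "\<And>x. x > 0 \<Longrightarrow> h x = h' x" "I = I'" "\<And>n x. n \<in> I' \<Longrightarrow> u n x = u' n x"
  shows "asymp_expansion_0 f h' I' u'"
  unfolding asymp_expansion_0_def
proof
  fix N
  have "(\<lambda>x. f x - (h x + (\<Sum>n | n \<in> I \<and> n \<le> N. u n x))) \<in> o[at_right 0](\<lambda>x. of_real x ^ N)"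
    using assms(1) by (simp add: asymp_expansion_0_def)
  also have "?this \<longleftrightarrow> (\<lambda>x. f x - (h' x + (\<Sum>n | n \<in> I' \<and> n \<le> N. u' n x))) \<in> o[at_right 0](\<lambda>x. of_real x ^ N)"
  proof (rule landau_o.small.in_cong)
    have *: "(\<Sum>n | n \<in> I \<and> n \<le> N. u n x) = (\<Sum>n | n \<in> I' \<and> n \<le> N. u' n x)" for x
      unfolding assms(3) by (rule sum.cong) (auto simp: assms(4))
    show "\<forall>\<^sub>F x in at_right 0. f x - (h x + (\<Sum>n | n \<in> I \<and> n \<le> N. u n x)) =
            f x - (h' x + (\<Sum>n | n \<in> I' \<and> n \<le> N. u' n x))"
      using eventually_at_right_less[of "0::real"] by eventually_elim (simp add: * assms(2))
  qed
  finally show "(\<lambda>x. f x - (h' x + (\<Sum>n | n \<in> I' \<and> n \<le> N. u' n x))) \<in> o[at_right 0](\<lambda>x. of_real x ^ N)" .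
qed

lemma residue_mellin_integrand_simple:
  assumes a: "a > 0" and x: "x > 0"
    and p: "- of_nat n \<noteq> (1 - u) / of_real a" "- of_nat n \<noteq> (1 - v) / of_real a"
  shows "residue (mellin_integrand a u v x) (- of_nat n) =
           (- of_real x) ^ n / fact n * zeta (u - of_real a * of_nat n) * zeta (v - of_real a * of_nat n)"
proof -
  let ?S = "- {(1 - u) / of_real a, (1 - v) / of_real a}"
  let ?h = "\<lambda>s. zeta (of_real a * s + u) * zeta (of_real a * s + v) / of_real x powr s"
  have "mellin_integrand a u v x = (\<lambda>s. Gamma s * ?h s)"
    by (simp add: mellin_integrand_def fun_eq_iff mult_ac)
  moreover have "residue (\<lambda>s. Gamma s * ?h s) (- of_nat n) = (-1) ^ n / fact n * ?h (- of_nat n)"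
  proof (rule residue_Gamma_times)
    show "open ?S" by (intro open_Compl finite_imp_closed) auto
    show "- of_nat n \<in> ?S" using p by auto
    show "?h holomorphic_on ?S" using x
      by (intro holomorphic_intros holomorphic_on_subset[OF zeta_affine_holomorphic[OF a]]) auto
  qed
  ultimately show ?thesis
    using x by (simp add: powr_minus powr_nat' power_minus[of "of_real x"] divide_inverse mult_ac)
qed

text \<open>This treats all four cases at once: an index n whose pole -n coincides with a zeta pole
  is dropped from the series, its contribution being part of the residue at \<open>s1\<close> or
  \<open>s2\<close>. As \<alpha> \<noteq> 0, the points \<open>s1\<close> and \<open>s2\<close>
  differ and both residues are counted.\<close>

theorem sigma_exp_sum_expansion:
  fixes a :: real and b \<alpha> :: complex
  defines "s1 \<equiv> (1 - b) / of_real a" and "s2 \<equiv> (1 - (b - \<alpha>)) / of_real a"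
  defines "F \<equiv> mellin_integrand a b (b - \<alpha>)"
  assumes a: "a > 0" and \<alpha>: "\<alpha> \<noteq> 0"
  shows "asymp_expansion_0 (sigma_exp_sum \<alpha> a b)
           (\<lambda>x. residue (F x) s1 + residue (F x) s2) {n. - of_nat n \<noteq> s1 \<and> - of_nat n \<noteq> s2}
           (\<lambda>n x. (- of_real x) ^ n / fact n * zeta (b - of_real a * of_nat n) *
                    zeta (b - of_real a * of_nat n - \<alpha>))"
    (is "asymp_expansion_0 _ ?h ?I ?u")
proof (rule asymp_expansion_0I)
  fix N
  define M where "M = max N (nat \<lceil>\<bar>Re s1\<bar> + \<bar>Re s2\<bar>\<rceil>)"
  have M: "M \<ge> N" "Re s1 > - real M - 1/2" "Re s2 > - real M - 1/2"
    unfolding M_def by linarith+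
  note expansion = mellin_integrand_expansion[OF a M(2,3)[unfolded s1_def s2_def], folded s1_def s2_def F_def]
  define J where "J = (LINT t|lborel. norm (F 1 (Complex (- real M - 1/2) t)))"
  have "norm (sigma_exp_sum \<alpha> a b x - (?h x + (\<Sum>n | n \<in> ?I \<and> n \<le> M. ?u n x))) \<le>
           J / (2 * pi) * x powr (real M + 1/2)" if x: "x > 0" for x
  proof -
    \<comment> \<open>Dropping from the first set the points that already lie in
      \<open>{s1, s2}\<close> makes the union disjoint.\<close>
    have "(\<lambda>n. - of_nat n) ` {..M} \<union> {s1, s2} =
          (\<lambda>n. - of_nat n) ` {n. n \<in> ?I \<and> n \<le> M} \<union> {s1, s2}" by auto
    hence "(\<Sum>p\<in>(\<lambda>n. - of_nat n) ` {..M} \<union> {s1, s2}. residue (F x) p) =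
      (\<Sum>p\<in>(\<lambda>n. - of_nat n) ` {n. n \<in> ?I \<and> n \<le> M} \<union> {s1, s2}. residue (F x) p)"
      by (rule arg_cong)
    also have "\<dots> = (\<Sum>p\<in>(\<lambda>n. - of_nat n) ` {n. n \<in> ?I \<and> n \<le> M}. residue (F x) p) +
                       (\<Sum>p\<in>{s1, s2}. residue (F x) p)"
      by (rule sum.union_disjoint) auto
    also have "(\<Sum>p\<in>(\<lambda>n. - of_nat n) ` {n. n \<in> ?I \<and> n \<le> M}. residue (F x) p) =
         (\<Sum>n | n \<in> ?I \<and> n \<le> M. residue (F x) (- of_nat n))"
      by (subst sum.reindex) (auto simp: inj_on_def)
    also have "\<dots> = (\<Sum>n | n \<in> ?I \<and> n \<le> M. ?u n x)"
    proof (rule sum.cong[OF refl])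
      fix n assume "n \<in> {n. n \<in> ?I \<and> n \<le> M}"
      hence "- of_nat n \<noteq> s1" "- of_nat n \<noteq> s2" by auto
      from residue_mellin_integrand_simple[OF a x this[unfolded s1_def s2_def]]
      moreover have "b - \<alpha> - of_real a * of_nat n = b - of_real a * of_nat n - \<alpha>" by simp
      ultimately show "residue (F x) (- of_nat n) = ?u n x" by (simp only: F_def)
    qed
    also have "(\<Sum>p\<in>{s1, s2}. residue (F x) p) = ?h x"
      using \<alpha> a by (simp add: s1_def s2_def)
    finally have "sigma_exp_sum \<alpha> a b x - (?h x + (\<Sum>n | n \<in> ?I \<and> n \<le> M. ?u n x)) =
        vertical_line_integral (- real M - 1/2) (F x) / (2 * of_real pi * \<i>)"
      unfolding expansion(2)[OF x] by (simp only: add_diff_cancel_right' add.commute)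
    hence "norm (sigma_exp_sum \<alpha> a b x - (?h x + (\<Sum>n | n \<in> ?I \<and> n \<le> M. ?u n x))) =
             norm (vertical_line_integral (- real M - 1/2) (F x)) / (2 * pi)"
      by (simp add: norm_divide norm_mult)
    also have "\<dots> \<le> J * x powr (- (- real M - 1/2)) / (2 * pi)"
      unfolding J_def F_def
      by (intro divide_right_mono vertical_line_integral_mellin_bound[OF x]
            expansion(1)[OF zero_less_one, unfolded F_def]) auto
    finally show ?thesis by (simp add: add.commute)
  qed
  thus "\<exists>M\<ge>N. \<exists>C. \<forall>x>0. norm (sigma_exp_sum \<alpha> a b x - (?h x + (\<Sum>n | n \<in> ?I \<and> n \<le> M. ?u n x)))
           \<le> C * x powr (real M + 1/2)"
    using M(1) by blast
next
  fix n
  show "\<exists>C. \<forall>x>0. norm (?u n x) \<le> C * x powr real n"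
  proof (intro exI allI impI)
    fix x :: real assume "x > 0"
    thus "norm (?u n x) \<le> norm (zeta (b - of_real a * of_nat n) * zeta (b - of_real a * of_nat n - \<alpha>)) / fact n
            * x powr real n"
      by (simp add: norm_mult norm_divide norm_power powr_realpow mult_ac)
  qed
qed

subsection \<open>Residues at the poles of the zeta factors\<close>

lemma zeta_affine_eq_zeta_reg:
  fixes s u :: complex
  assumes "a > 0" "s \<noteq> (1 - u) / of_real a"
  shows "zeta (of_real a * s + u) =
           zeta_reg (of_real a * s + u) / of_real a / (s - (1 - u) / of_real a)"
proof -
  have "of_real a * s + u - 1 = of_real a * (s - (1 - u) / of_real a)"
    using assms by (simp add: field_simps)
  moreover have "of_real a * s + u \<noteq> 1" using assms by (simp only: affine_eq_1_iff not_False_eq_True)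
  ultimately show ?thesis by (simp add: zeta_eq_zeta_reg)
qed

lemma zeta_reg_affine_holomorphic:
  "(\<lambda>s. zeta_reg (of_real a * s + u)) holomorphic_on A"
  by (rule holomorphic_on_compose_gen[OF _ zeta_reg_entire[of UNIV], unfolded o_def])
     (auto intro!: holomorphic_intros)

lemma zeta_affine_at_other_pole:
  fixes u v :: complex
  assumes "a > 0"
  shows "of_real a * ((1 - u) / of_real a) + u = 1"
    and "of_real a * ((1 - u) / of_real a) + v = 1 + v - u"
  using assms by simp_all

text \<open>Only the first zeta factor is singular here: \<open>p\<close> excludes the poles of
  \<Gamma>, and u \<noteq> v separates the point from the pole of the other zeta factor. The factor
  1 / a is the residue of \<zeta>(a s + u).\<close>

lemma residue_mellin_integrand_zeta_pole:
  fixes u v :: complex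
  assumes a: "a > 0" and x: "x > 0" and uv: "u \<noteq> v"
    and p: "\<And>n. - of_nat n \<noteq> (1 - u) / of_real a"
  shows "residue (mellin_integrand a u v x) ((1 - u) / of_real a) =
           of_real x powr (- ((1 - u) / of_real a)) / of_real a *
             Gamma ((1 - u) / of_real a) * zeta (1 + v - u)"
proof -
  define s1 where "s1 = (1 - u) / of_real a"
  define S where "S = - \<int>\<^sub>\<le>\<^sub>0 \<inter> - {(1 - v) / of_real a}"
  define g where "g = (\<lambda>s. Gamma s * (zeta_reg (of_real a * s + u) / of_real a) *
                          zeta (of_real a * s + v) / of_real x powr s)"
  have S: "open S" unfolding S_def by (intro open_Int open_Compl closed_nonpos_Ints) auto
  have "s1 \<notin> \<int>\<^sub>\<le>\<^sub>0" using p unfolding s1_def[symmetric] by (metis nonpos_Ints_cases')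
  hence s1: "s1 \<in> S" using uv a by (auto simp: S_def s1_def)
  have g: "g holomorphic_on S" unfolding g_def using x a
    by (intro holomorphic_intros zeta_reg_affine_holomorphic
          holomorphic_on_subset[OF zeta_affine_holomorphic[OF a]]) (auto simp: S_def)
  have "mellin_integrand a u v x s = g s / (s - s1) ^ Suc 0" if "s \<noteq> s1" for s
    using zeta_affine_eq_zeta_reg[OF a, of s u] that
    by (simp add: mellin_integrand_def g_def s1_def)
  hence "residue (mellin_integrand a u v x) s1 = residue (\<lambda>s. g s / (s - s1) ^ Suc 0) s1"
    by (intro residue_cong) (auto simp: eventually_at_filter)
  also have "\<dots> = (deriv ^^ 0) g s1 / fact 0"
    by (rule residue_holomorphic_over_power[OF S s1 g])
  also have "\<dots> = of_real x powr (- s1) / of_real a * Gamma s1 * zeta (1 + v - u)"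
  proof -
    have "of_real a * s1 + u = 1" "of_real a * s1 + v = 1 + v - u"
      using zeta_affine_at_other_pole[OF a, of u] by (simp_all add: s1_def)
    thus ?thesis by (simp add: g_def zeta_reg_1 powr_minus_divide mult_ac diff_add_eq)
  qed
  finally show ?thesis by (simp add: s1_def)
qed

text \<open>\<open>Gamma_reg m s = (s + m) \<Gamma>(s)\<close>, continued analytically to the pole \<open>s = - m\<close>.\<close>

primrec Gamma_reg :: "nat \<Rightarrow> complex \<Rightarrow> complex" where
  "Gamma_reg 0 s = Gamma (s + 1)"
| "Gamma_reg (Suc m) s = Gamma_reg m (s + 1) / s"

lemma not_nonpos_Int_near:
  assumes "s \<in> ball (- of_nat m) 1" "s \<noteq> - of_nat m"
  shows "s \<notin> (\<int>\<^sub>\<le>\<^sub>0 :: complex set)"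
proof
  assume "s \<in> \<int>\<^sub>\<le>\<^sub>0"
  then obtain k where k: "s = - of_nat k" by (elim nonpos_Ints_cases')
  have "dist (- of_nat m) s = norm (of_real (real k - real m) :: complex)"
    by (simp add: k dist_norm)
  also have "\<dots> = \<bar>real k - real m\<bar>" by (rule norm_of_real)
  finally have "dist (- of_nat m) s = \<bar>real k - real m\<bar>" .
  with assms(1) have "\<bar>real k - real m\<bar> < 1" by simp
  hence "k = m" by linarith
  thus False using k assms(2) by simp
qed

lemma plus_1_in_ball:
  assumes "s \<in> ball (- of_nat (Suc m)) 1"
  shows "s + 1 \<in> ball (- of_nat m :: complex) 1"
proof -
  have "- of_nat m - (s + 1) = - of_nat (Suc m) - s" by simp
  thus ?thesis using assms by (simp only: mem_ball dist_norm)
qed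

lemma Gamma_eq_Gamma_reg:
  assumes "s \<in> ball (- of_nat m) 1" "s \<noteq> - of_nat m"
  shows "Gamma s = Gamma_reg m s / (s + of_nat m)"
  using assms
proof (induction m arbitrary: s)
  case 0
  thus ?case using not_nonpos_Int_near[of s 0] Gamma_plus1[of s] by auto
next
  case (Suc m)
  have s: "s \<notin> \<int>\<^sub>\<le>\<^sub>0" using Suc.prems by (rule not_nonpos_Int_near)
  have "s + 1 \<in> ball (- of_nat m) 1"
    using Suc.prems(1) by (rule plus_1_in_ball)
  moreover have "s + 1 \<noteq> - of_nat m"
  proof
    assume "s + 1 = - of_nat m"
    hence "s + 1 - 1 = - of_nat m - 1" by (rule arg_cong)
    thus False using Suc.prems(2) by simp
  qed
  ultimately have "Gamma (s + 1) = Gamma_reg m (s + 1) / (s + 1 + of_nat m)" by (rule Suc.IH)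
  moreover have "Gamma (s + 1) = s * Gamma s" using s by (rule Gamma_plus1)
  moreover have "s \<noteq> 0" using s by auto
  ultimately have "Gamma s = Gamma_reg m (s + 1) / (s + 1 + of_nat m) / s"
    by (metis nonzero_mult_div_cancel_left)
  thus ?case by (simp add: add_ac)
qed

text \<open>Radius 1 keeps the neighbouring poles of \<Gamma> out. In the induction step it also
  excludes 0, so the division by s is harmless.\<close>

lemma Gamma_reg_holomorphic: "Gamma_reg m holomorphic_on ball (- of_nat m) 1"
proof (induction m)
  case 0
  have "s + 1 \<notin> \<int>\<^sub>\<le>\<^sub>0" if "s \<in> ball (0::complex) 1" for s
  proof -
    have "\<bar>Re s\<bar> < 1" using that abs_Re_le_cmod[of s] by simp
    hence "Re (s + 1) > 0" by simp
    thus ?thesis by (metis Re_complex_of_real nonpos_Ints_cases' not_less of_nat_0_le_iff of_real_minus of_real_of_nat_eq neg_le_0_iff_le)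
  qed
  thus ?case by (auto intro!: holomorphic_intros)
next
  case (Suc m)
  have "(\<lambda>s. Gamma_reg m (s + 1)) holomorphic_on ball (- of_nat (Suc m)) 1"
  proof (rule holomorphic_on_compose_gen[OF _ Suc.IH, unfolded o_def])
    show "(\<lambda>s. s + 1) holomorphic_on ball (- of_nat (Suc m)) 1" by (intro holomorphic_intros)
  qed (use plus_1_in_ball in blast)
  moreover have "s \<noteq> 0" if "s \<in> ball (- of_nat (Suc m)) 1" for s :: complex
  proof
    assume "s = 0"
    hence "norm (of_nat (Suc m) :: complex) < 1" using that by (simp add: dist_norm del: of_nat_Suc)
    thus False by (simp only: norm_of_nat)
  qed
  ultimately have "(\<lambda>s. Gamma_reg m (s + 1) / s) holomorphic_on ball (- of_nat (Suc m)) 1"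
    by (intro holomorphic_on_divide holomorphic_on_ident)
  thus ?case by (simp only: Gamma_reg.simps(2)[abs_def])
qed

lemma sign_fact_Suc:
  "(-1) ^ m / fact m / (- of_nat (Suc m)) = ((-1) ^ Suc m / fact (Suc m) :: complex)"
  by (simp add: field_simps del: of_nat_Suc)

lemma Gamma_reg_at_pole: "Gamma_reg m (- of_nat m) = (-1) ^ m / fact m"
proof (induction m)
  case (Suc m)
  have "Gamma_reg (Suc m) (- of_nat (Suc m)) = Gamma_reg m (- of_nat m) / (- of_nat (Suc m))"
    by simp
  also have "\<dots> = (-1) ^ Suc m / fact (Suc m)" unfolding Suc.IH by (rule sign_fact_Suc)
  finally show ?case .
qed auto

text \<open>In logarithmic derivatives, dividing by s adds -1 / s, which is 1 / (m + 1) at s = -(m +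
  1); this matches the recurrence of the digamma function.\<close>

lemma Gamma_reg_has_deriv:
  "(Gamma_reg m has_field_derivative ((-1) ^ m / fact m * Digamma (of_nat (m + 1)))) (at (- of_nat m))"
proof (induction m)
  case 0
  have "((\<lambda>s. Gamma (s + 1)) has_field_derivative (Gamma 1 * Digamma 1)) (at (0::complex))"
    by (rule derivative_eq_intros refl | simp)+
  thus ?case by simp
next
  case (Suc m)
  let ?p = "- of_nat (Suc m) :: complex"
  let ?c = "(-1) ^ m / fact m :: complex"
  have "((\<lambda>s. Gamma_reg m (s + 1)) has_field_derivative (?c * Digamma (of_nat (m + 1)) * 1)) (at ?p)"
    using Suc.IH DERIV_shift[of "Gamma_reg m" _ ?p 1] by simp
  from DERIV_divide[OF this DERIV_ident]
  have "((\<lambda>s. Gamma_reg m (s + 1) / s) has_field_derivative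
      ((?c * Digamma (of_nat (m + 1)) * 1) * ?p - Gamma_reg m (?p + 1) * 1) / (?p * ?p)) (at ?p)"
    by (simp del: of_nat_Suc)
  also have "?p + 1 = - of_nat m" by simp
  also have "Gamma_reg m (- of_nat m) = ?c" by (rule Gamma_reg_at_pole)
  finally have deriv: "((\<lambda>s. Gamma_reg m (s + 1) / s) has_field_derivative
      ((?c * Digamma (of_nat (m + 1)) * 1) * ?p - ?c * 1) / (?p * ?p)) (at ?p)" .
  have "(?c * D * 1 * - N - ?c * 1) / (- N * - N) = (?c / - N) * (D + 1 / N)"
    if "N \<noteq> 0" for D N :: complex
    using that by (simp add: field_simps)
  from this[of "of_nat (Suc m)" "Digamma (of_nat (m + 1))"]
  have "((?c * Digamma (of_nat (m + 1)) * 1) * ?p - ?c * 1) / (?p * ?p) =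
          (?c / ?p) * (Digamma (of_nat (m + 1)) + 1 / of_nat (Suc m))"
    by (simp only: of_nat_eq_0_iff nat.simps not_False_eq_True)
  also have "Digamma (of_nat (m + 1)) + 1 / of_nat (Suc m) = Digamma (of_nat (Suc m + 1) :: complex)"
  proof -
    have "(of_nat (m + 1) :: complex) \<noteq> 0" by (simp only: of_nat_eq_0_iff)
    from Digamma_plus1[OF this] show ?thesis by (simp only: of_nat_add of_nat_1 Suc_eq_plus1)
  qed
  also have "?c / ?p = (-1) ^ Suc m / fact (Suc m)" by (rule sign_fact_Suc)
  finally show ?case using deriv by (simp only: Gamma_reg.simps(2)[abs_def])
qed

text \<open>Near the pole the integrand is g(s) / (s - s1)^2 with \<open>g\<close> holomorphic, so
  the residue is the derivative of \<open>g\<close> at \<open>s1\<close>. The product rule over the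
  four factors of \<open>g\<close> gives the four terms in the bracket. As u \<noteq> v, the other
  zeta factor is evaluated away from its pole.\<close>

lemma residue_mellin_integrand_double_pole:
  fixes u v :: complex
  assumes a: "a > 0" and x: "x > 0" and uv: "u \<noteq> v" and p: "- of_nat m = (1 - u) / of_real a"
  shows "residue (mellin_integrand a u v x) (- of_nat m) =
           (- of_real x) ^ m
              * (of_real a * deriv zeta (1 + v - u)
                 + zeta (1 + v - u)
                   * (euler_mascheroni * of_real a + Digamma (of_nat (m + 1)) - of_real (ln x)))
              / (of_real a * fact m)"
proof -
  define s1 :: complex where "s1 = - of_nat m"
  define S where "S = ball s1 1 \<inter> - {(1 - v) / of_real a}"
  define g where "g = (\<lambda>s. Gamma_reg m s * (zeta_reg (of_real a * s + u) / of_real a) *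
                          (zeta (of_real a * s + v) * of_real x powr (- s)))"
  have S: "open S" unfolding S_def by (intro open_Int open_Compl) auto
  have s1_eq: "s1 = (1 - u) / of_real a" using p by (simp add: s1_def)
  have s1: "s1 \<in> S" using uv a by (auto simp: S_def s1_eq)
  have g: "g holomorphic_on S" unfolding g_def using x a
    by (intro holomorphic_intros zeta_reg_affine_holomorphic
          holomorphic_on_subset[OF zeta_affine_holomorphic[OF a]]
          holomorphic_on_subset[OF Gamma_reg_holomorphic])
       (auto simp: S_def s1_def)
  have "mellin_integrand a u v x s = g s / (s - s1) ^ Suc 1" if "s \<noteq> s1" "s \<in> S" for s
    using zeta_affine_eq_zeta_reg[OF a, of s u] Gamma_eq_Gamma_reg[of s m] that
    by (simp add: mellin_integrand_def g_def s1_eq[symmetric] S_def powr_minus_divide power2_eq_square)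
       (simp add: s1_def)
  hence "residue (mellin_integrand a u v x) s1 = residue (\<lambda>s. g s / (s - s1) ^ Suc 1) s1"
    using eventually_nhds_in_open[OF S s1]
    by (intro residue_cong) (auto simp: eventually_at_filter elim!: eventually_mono)
  also have "\<dots> = deriv g s1"
    using residue_holomorphic_over_power[OF S s1 g, of 1] by simp
  also have "\<dots> = (- of_real x) ^ m
              * (of_real a * deriv zeta (1 + v - u)
                 + zeta (1 + v - u)
                   * (euler_mascheroni * of_real a + Digamma (of_nat (m + 1)) - of_real (ln x)))
              / (of_real a * fact m)"
  proof (rule DERIV_imp_deriv)
    define G where "G = ((-1) ^ m / fact m :: complex)"
    have at1: "of_real a * s1 + u = 1" and at2: "of_real a * s1 + v = 1 + v - u"
      using zeta_affine_at_other_pole[OF a, of u] by (simp_all add: s1_eq)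
    have "(zeta has_field_derivative deriv zeta (1 + v - u)) (at (1 + v - u))"
      using zeta_holomorphic uv by (intro holomorphic_derivI[of _ "- {1}"]) auto
    hence dz: "((\<lambda>s. zeta (of_real a * s + v)) has_field_derivative (deriv zeta (1 + v - u) * of_real a)) (at s1)"
      unfolding at2[symmetric] by (rule DERIV_chain2) (auto intro!: derivative_eq_intros)
    have "(zeta_reg has_field_derivative euler_mascheroni) (at (of_real a * s1 + u))"
      unfolding at1 by (rule zeta_reg_has_deriv_1)
    hence dr: "((\<lambda>s. zeta_reg (of_real a * s + u)) has_field_derivative (euler_mascheroni * of_real a)) (at s1)"
      by (rule DERIV_chain2) (auto intro!: derivative_eq_intros)
    have dG: "(Gamma_reg m has_field_derivative (G * Digamma (of_nat (m + 1)))) (at s1)"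
      unfolding G_def s1_def by (rule Gamma_reg_has_deriv)
    have xp: "of_real x powr (- s1) = (of_real x ^ m :: complex)"
      using x by (simp add: s1_def powr_nat')
    have dx: "((\<lambda>s. of_real x powr (- s)) has_field_derivative (- of_real (ln x) * of_real x ^ m)) (at s1)"
    proof -
      have "((\<lambda>s. of_real x powr (- s)) has_field_derivative
               (Ln (of_real x) * of_real x powr (- s1) * (- 1))) (at s1)"
        by (rule DERIV_chain2[OF has_field_derivative_powr_right])
           (use x in \<open>auto intro!: derivative_eq_intros\<close>)
      thus ?thesis using x by (simp add: xp Ln_of_real)
    qed
    have G: "Gamma_reg m s1 = G" by (simp add: G_def s1_def Gamma_reg_at_pole)
    note d = DERIV_mult[OF DERIV_mult[OF dG DERIV_cdivide[OF dr, of "of_real a"]] DERIV_mult[OF dz dx]]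
    have "(g has_field_derivative
       ((G * Digamma (of_nat (m + 1)) * (1 / of_real a) + euler_mascheroni * of_real a / of_real a * G) *
         (zeta (1 + v - u) * of_real x ^ m) +
        (deriv zeta (1 + v - u) * of_real a * of_real x ^ m +
         - of_real (ln x) * of_real x ^ m * zeta (1 + v - u)) * (G * (1 / of_real a)))) (at s1)"
      using d unfolding g_def at1 at2 G xp zeta_reg_1 .
    also have "((G * Digamma (of_nat (m + 1)) * (1 / of_real a) + euler_mascheroni * of_real a / of_real a * G) *
         (zeta (1 + v - u) * of_real x ^ m) +
        (deriv zeta (1 + v - u) * of_real a * of_real x ^ m +
         - of_real (ln x) * of_real x ^ m * zeta (1 + v - u)) * (G * (1 / of_real a))) =
        G * of_real x ^ m * (of_real a * deriv zeta (1 + v - u)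
                 + zeta (1 + v - u)
                   * (euler_mascheroni * of_real a + Digamma (of_nat (m + 1)) - of_real (ln x))) / of_real a"
      using a by (simp add: field_simps)
    also have "\<dots> = (- of_real x) ^ m
              * (of_real a * deriv zeta (1 + v - u)
                 + zeta (1 + v - u)
                   * (euler_mascheroni * of_real a + Digamma (of_nat (m + 1)) - of_real (ln x)))
              / (of_real a * fact m)"
      by (simp add: G_def power_minus[of "of_real x"])
    finally show "(g has_field_derivative (- of_real x) ^ m
              * (of_real a * deriv zeta (1 + v - u)
                 + zeta (1 + v - u)
                   * (euler_mascheroni * of_real a + Digamma (of_nat (m + 1)) - of_real (ln x)))
              / (of_real a * fact m)) (at s1)" .
  qed
  finally show ?thesis by (simp add: s1_def)
qed

section \<open>The residues in the parameters of the four cases\<close>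

lemma minus_of_nat_eq_divide_iff:
  fixes u :: complex
  assumes "a > 0"
  shows "- of_nat n = (1 - u) / of_real a \<longleftrightarrow> of_real a * of_nat n = u - 1"
proof -
  have "- of_nat n = (1 - u) / of_real a \<longleftrightarrow> - of_nat n * of_real a = 1 - u"
    using assms by (simp add: eq_divide_eq)
  also have "\<dots> \<longleftrightarrow> - (- of_nat n * of_real a) = - (1 - u)" by (simp only: neg_equal_iff_equal)
  also have "- (- of_nat n * of_real a) = of_real a * (of_nat n :: complex)" by simp
  also have "- (1 - u) = u - 1" by simp
  finally show ?thesis .
qed

context
  fixes a x :: real and b \<alpha> :: complex
  assumes a: "a > 0" and x: "x > 0" and \<alpha>: "\<alpha> \<noteq> 0"
begin

lemma residue_at_first_zeta_pole:
  assumes "\<And>n. of_real a * of_nat n \<noteq> b - 1"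
  shows "residue (mellin_integrand a b (b - \<alpha>) x) ((1 - b) / of_real a) =
           of_real x powr ((b - 1) / of_real a) / of_real a
              * Gamma ((1 - b) / of_real a) * zeta (1 - \<alpha>)"
proof -
  have "- of_nat n \<noteq> (1 - b) / of_real a" for n
    using assms[of n] a by (subst minus_of_nat_eq_divide_iff) auto
  moreover have "- ((1 - b) / of_real a) = (b - 1) / of_real a" "1 + (b - \<alpha>) - b = 1 - \<alpha>"
    by (simp_all add: minus_divide_left)
  ultimately show ?thesis
    using residue_mellin_integrand_zeta_pole[OF a x, of b "b - \<alpha>"] \<alpha> by simp
qed

lemma residue_at_second_zeta_pole:
  assumes "\<And>n. of_real a * of_nat n \<noteq> b - 1 - \<alpha>"
  shows "residue (mellin_integrand a b (b - \<alpha>) x) ((1 - (b - \<alpha>)) / of_real a) =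
           of_real x powr ((b - 1 - \<alpha>) / of_real a) / of_real a
              * Gamma ((1 - b + \<alpha>) / of_real a) * zeta (1 + \<alpha>)"
proof -
  have p: "- of_nat n \<noteq> (1 - (b - \<alpha>)) / of_real a" for n
    using assms[of n] a by (subst minus_of_nat_eq_divide_iff) (auto simp: diff_right_commute)
  have e: "1 - b + \<alpha> = 1 - (b - \<alpha>)" "1 + b - (b - \<alpha>) = 1 + \<alpha>"
       "- ((1 - (b - \<alpha>)) / of_real a) = (b - 1 - \<alpha>) / of_real a"
    by (simp_all add: minus_divide_left algebra_simps)
  have "b - \<alpha> \<noteq> b" using \<alpha> by simp
  from residue_mellin_integrand_zeta_pole[OF a x this p]
  show ?thesis unfolding e mellin_integrand_commute[of a b] .
qed

lemma residue_at_first_double_pole: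
  assumes m: "of_real a * of_nat m = b - 1"
  shows "residue (mellin_integrand a b (b - \<alpha>) x) ((1 - b) / of_real a) =
           (- of_real x) ^ m
              * (of_real a * deriv zeta (1 - \<alpha>)
                 + zeta (1 - \<alpha>)
                   * (euler_mascheroni * of_real a + Digamma (of_nat (m + 1)) - of_real (ln x)))
              / (of_real a * fact m)"
proof -
  have p: "- of_nat m = (1 - b) / of_real a"
    using m a by (subst minus_of_nat_eq_divide_iff) auto
  have "1 + (b - \<alpha>) - b = 1 - \<alpha>" by simp
  thus ?thesis using residue_mellin_integrand_double_pole[OF a x _ p, of "b - \<alpha>"] \<alpha>
    by (simp only: p) simp
qed

lemma residue_at_second_double_pole:
  assumes m: "of_real a * of_nat m = b - 1 - \<alpha>"
  shows "residue (mellin_integrand a b (b - \<alpha>) x) ((1 - (b - \<alpha>)) / of_real a) =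
           (- of_real x) ^ m
              * (of_real a * deriv zeta (1 + \<alpha>)
                 + zeta (1 + \<alpha>)
                   * (euler_mascheroni * of_real a + Digamma (of_nat (m + 1)) - of_real (ln x)))
              / (of_real a * fact m)"
proof -
  have p: "- of_nat m = (1 - (b - \<alpha>)) / of_real a"
    using m a by (subst minus_of_nat_eq_divide_iff) (auto simp: diff_right_commute)
  have "1 + b - (b - \<alpha>) = 1 + \<alpha>" by simp
  thus ?thesis using residue_mellin_integrand_double_pole[OF a x _ p, of b] \<alpha>
    by (simp only: p mellin_integrand_commute[of a b]) simp
qed

end

theorem corollary6:
  fixes \<alpha> b :: complex and a :: real
  assumes "\<alpha> \<noteq> 0" and "a > 0"
  shows
    "(\<forall>x c :: real. x > 0 \<longrightarrow> c > 0 \<longrightarrow> c > max (1 - Re b) (1 - Re (b - \<alpha>)) / a \<longrightarrow>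
       summable (\<lambda>n. sigma_exp_term \<alpha> a b x (Suc n)) \<and>
       vertical_line_integrable c
         (\<lambda>s. Gamma s * zeta (of_real a * s + b) * zeta (of_real a * s + b - \<alpha>) / of_real x powr s) \<and>
       1 / (2 * of_real pi * \<i>) * vertical_line_integral c
         (\<lambda>s. Gamma s * zeta (of_real a * s + b) * zeta (of_real a * s + b - \<alpha>) / of_real x powr s)
       = sigma_exp_sum \<alpha> a b x) \<and>
    ((\<forall>n::nat. of_real a * of_nat n \<noteq> b - 1) \<longrightarrow>
     (\<forall>n::nat. of_real a * of_nat n \<noteq> b - 1 - \<alpha>) \<longrightarrow>
     asymp_expansion_0 (sigma_exp_sum \<alpha> a b)
       (\<lambda>x. of_real x powr ((b - 1) / of_real a) / of_real a
              * Gamma ((1 - b) / of_real a) * zeta (1 - \<alpha>)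
          + of_real x powr ((b - 1 - \<alpha>) / of_real a) / of_real a
              * Gamma ((1 - b + \<alpha>) / of_real a) * zeta (1 + \<alpha>))
       UNIV
       (\<lambda>n x. (- of_real x) ^ n / fact n
              * zeta (b - of_real a * of_nat n) * zeta (b - of_real a * of_nat n - \<alpha>))) \<and>
    (\<forall>m::nat. of_real a * of_nat m = b - 1 \<longrightarrow>
     (\<forall>n::nat. of_real a * of_nat n \<noteq> b - 1 - \<alpha>) \<longrightarrow>
     asymp_expansion_0 (sigma_exp_sum \<alpha> a b)
       (\<lambda>x. (- of_real x) ^ m
              * (of_real a * deriv zeta (1 - \<alpha>)
                 + zeta (1 - \<alpha>)
                   * (euler_mascheroni * of_real a + Digamma (of_nat (m + 1)) - of_real (ln x)))
              / (of_real a * fact m)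
          + of_real x powr (of_nat m - \<alpha> / of_real a) / of_real a
              * Gamma ((\<alpha> - of_nat m * of_real a) / of_real a) * zeta (1 + \<alpha>))
       (UNIV - {m})
       (\<lambda>n x. (- of_real x) ^ n / fact n
              * zeta (1 - of_real a * (of_nat n - of_nat m))
              * zeta (1 - \<alpha> - of_real a * (of_nat n - of_nat m)))) \<and>
    (\<forall>m::nat. (\<forall>n::nat. of_real a * of_nat n \<noteq> b - 1) \<longrightarrow>
     of_real a * of_nat m = b - 1 - \<alpha> \<longrightarrow>
     asymp_expansion_0 (sigma_exp_sum \<alpha> a b)
       (\<lambda>x. of_real x powr (of_nat m + \<alpha> / of_real a) / of_real a
              * Gamma (- ((of_real a * of_nat m + \<alpha>) / of_real a)) * zeta (1 - \<alpha>)
          + (- of_real x) ^ m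
              * (of_real a * deriv zeta (1 + \<alpha>)
                 + zeta (1 + \<alpha>)
                   * (euler_mascheroni * of_real a + Digamma (of_nat (m + 1)) - of_real (ln x)))
              / (of_real a * fact m))
       (UNIV - {m})
       (\<lambda>n x. (- of_real x) ^ n / fact n
              * zeta (1 + \<alpha> - of_real a * (of_nat n - of_nat m))
              * zeta (1 - of_real a * (of_nat n - of_nat m)))) \<and>
    (\<forall>m l :: nat. of_real a * of_nat m = b - 1 \<longrightarrow>
     \<alpha> = of_real a * (of_nat m - of_nat l) \<longrightarrow> m \<noteq> l \<longrightarrow>
     asymp_expansion_0 (sigma_exp_sum \<alpha> a b)
       (\<lambda>x. (- of_real x) ^ m
              * (of_real a * deriv zeta (1 - of_real a * (of_nat m - of_nat l))
                 + zeta (1 - of_real a * (of_nat m - of_nat l))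
                   * (euler_mascheroni * of_real a + Digamma (of_nat (m + 1)) - of_real (ln x)))
              / (of_real a * fact m)
          + (- of_real x) ^ l
              * (of_real a * deriv zeta (1 + of_real a * (of_nat m - of_nat l))
                 + zeta (1 + of_real a * (of_nat m - of_nat l))
                   * (euler_mascheroni * of_real a + Digamma (of_nat (l + 1)) - of_real (ln x)))
              / (of_real a * fact l))
       (UNIV - {m, l})
       (\<lambda>n x. (- of_real x) ^ n / fact n
              * zeta (1 - of_real a * (of_nat n - of_nat m))
              * zeta (1 - of_real a * (of_nat n - of_nat l))))"
proof -
  have a: "a > 0" and \<alpha>: "\<alpha> \<noteq> 0" by fact+
  have "b - \<alpha> - 1 = b - 1 - \<alpha>" by simp
  \<comment> \<open>The index set is restated through a n \<noteq> b - 1 and a n \<noteq> b - 1 -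
    \<alpha>, the conditions that distinguish the cases.\<close>
  note expansion = sigma_exp_sum_expansion[OF a \<alpha>, of b, unfolded minus_of_nat_eq_divide_iff[OF a] this]
  note simple1 = residue_at_first_zeta_pole[OF a _ \<alpha>]
  note simple2 = residue_at_second_zeta_pole[OF a _ \<alpha>]
  note double1 = residue_at_first_double_pole[OF a _ \<alpha>]
  note double2 = residue_at_second_double_pole[OF a _ \<alpha>]
  \<comment> \<open>Since a is nonzero, a zeta pole meets at most one of the points -n, so each
    coincidence removes exactly one index.\<close>
  have unique: "of_real a * of_nat n = z \<longleftrightarrow> n = k"
    if "of_real a * of_nat k = z" for n k :: nat and z :: complex
    unfolding that[symmetric] using a by simp
  have a_nz: "of_real a \<noteq> (0 :: complex)" using a by simp
  have line: "a * c + Re b > 1" "a * c + Re (b - \<alpha>) > 1"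
    if "c > max (1 - Re b) (1 - Re (b - \<alpha>)) / a" for c
  proof -
    have "max (1 - Re b) (1 - Re (b - \<alpha>)) < a * c"
      using that a by (simp add: divide_less_eq mult.commute)
    thus "a * c + Re b > 1" "a * c + Re (b - \<alpha>) > 1" by auto
  qed
  show ?thesis
  \<comment> \<open>Goals 1 to 3 are summability, integrability and the value of the integral; goals
    4 to 7 are the expansions (i) to (iv).\<close>
  proof (intro conjI allI impI, goal_cases)
    case (1 x c)
    show ?case by (rule sigma_exp_sum_mellin(1)[OF 1(1,2) a line[OF 1(3)]])
  next
    case (2 x c)
    show ?case by (rule sigma_exp_sum_mellin(2)[OF 2(1,2) a line[OF 2(3)]])
  next
    case (3 x c)
    show ?case unfolding sigma_exp_sum_mellin(3)[OF 3(1,2) a line[OF 3(3)]] by simp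
  next
    case 4
    show ?case
    proof (rule asymp_expansion_0_cong[OF expansion])
      show "residue (mellin_integrand a b (b - \<alpha>) x) ((1 - b) / of_real a)
              + residue (mellin_integrand a b (b - \<alpha>) x) ((1 - (b - \<alpha>)) / of_real a) =
            of_real x powr ((b - 1) / of_real a) / of_real a
              * Gamma ((1 - b) / of_real a) * zeta (1 - \<alpha>)
            + of_real x powr ((b - 1 - \<alpha>) / of_real a) / of_real a
              * Gamma ((1 - b + \<alpha>) / of_real a) * zeta (1 + \<alpha>)" if "x > 0" for x
        using simple1[OF that 4(1)[rule_format]] simple2[OF that 4(2)[rule_format]] by (simp only:)
    qed (use 4 in auto)
  next
    case (5 m)
    hence b: "b = 1 + of_real a * of_nat m" by (simp add: algebra_simps)
    have e: "(b - 1 - \<alpha>) / of_real a = of_nat m - \<alpha> / of_real a"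
            "(1 - b + \<alpha>) / of_real a = (\<alpha> - of_nat m * of_real a) / of_real a"
      using a_nz by (simp_all add: b diff_divide_distrib)
    show ?case
    proof (rule asymp_expansion_0_cong[OF expansion])
      show "residue (mellin_integrand a b (b - \<alpha>) x) ((1 - b) / of_real a) + residue (mellin_integrand a b (b - \<alpha>) x) ((1 - (b - \<alpha>)) / of_real a) = 
         (- of_real x) ^ m
              * (of_real a * deriv zeta (1 - \<alpha>)
                 + zeta (1 - \<alpha>)
                   * (euler_mascheroni * of_real a + Digamma (of_nat (m + 1)) - of_real (ln x)))
              / (of_real a * fact m)
          + of_real x powr (of_nat m - \<alpha> / of_real a) / of_real a
              * Gamma ((\<alpha> - of_nat m * of_real a) / of_real a) * zeta (1 + \<alpha>)" if "x > 0" for x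
        using double1[OF that 5(1)] simple2[OF that 5(2)[rule_format]] unfolding e by (simp only:)
      show "{n. of_real a * of_nat n \<noteq> b - 1 \<and> of_real a * of_nat n \<noteq> b - 1 - \<alpha>} = UNIV - {m}"
        using 5(2) unique[OF 5(1)] by auto
    qed (simp add: b algebra_simps)
  next
    case (6 m)
    hence b: "b = 1 + \<alpha> + of_real a * of_nat m" by (simp add: algebra_simps)
    have e: "(b - 1) / of_real a = of_nat m + \<alpha> / of_real a"
            "(1 - b) / of_real a = - ((of_real a * of_nat m + \<alpha>) / of_real a)"
      using a_nz by (simp_all add: b add_divide_distrib diff_divide_distrib)
    show ?case
    proof (rule asymp_expansion_0_cong[OF expansion])
      show "residue (mellin_integrand a b (b - \<alpha>) x) ((1 - b) / of_real a) + residue (mellin_integrand a b (b - \<alpha>) x) ((1 - (b - \<alpha>)) / of_real a) = 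
         of_real x powr (of_nat m + \<alpha> / of_real a) / of_real a
              * Gamma (- ((of_real a * of_nat m + \<alpha>) / of_real a)) * zeta (1 - \<alpha>)
          + (- of_real x) ^ m
              * (of_real a * deriv zeta (1 + \<alpha>)
                 + zeta (1 + \<alpha>)
                   * (euler_mascheroni * of_real a + Digamma (of_nat (m + 1)) - of_real (ln x)))
              / (of_real a * fact m)" if "x > 0" for x
        using double2[OF that 6(2)] simple1[OF that 6(1)[rule_format]] unfolding e by (simp only:)
      show "{n. of_real a * of_nat n \<noteq> b - 1 \<and> of_real a * of_nat n \<noteq> b - 1 - \<alpha>} = UNIV - {m}"
        using 6(1) unique[OF 6(2)] by auto
    qed (simp add: b algebra_simps)
  next
    case (7 m l)
    hence b: "b = 1 + of_real a * of_nat m" by (simp add: algebra_simps)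
    \<comment> \<open>The relation \<alpha> = a (m - l) places the second zeta pole at -l, so both
      zeta poles are double poles.\<close>
    have l: "of_real a * of_nat l = b - 1 - \<alpha>" by (simp add: b 7(2) algebra_simps)
    show ?case
    proof (rule asymp_expansion_0_cong[OF expansion])
      show "residue (mellin_integrand a b (b - \<alpha>) x) ((1 - b) / of_real a) + residue (mellin_integrand a b (b - \<alpha>) x) ((1 - (b - \<alpha>)) / of_real a) = 
          (- of_real x) ^ m
              * (of_real a * deriv zeta (1 - of_real a * (of_nat m - of_nat l))
                 + zeta (1 - of_real a * (of_nat m - of_nat l))
                   * (euler_mascheroni * of_real a + Digamma (of_nat (m + 1)) - of_real (ln x)))
              / (of_real a * fact m)
          + (- of_real x) ^ l
              * (of_real a * deriv zeta (1 + of_real a * (of_nat m - of_nat l))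
                 + zeta (1 + of_real a * (of_nat m - of_nat l))
                   * (euler_mascheroni * of_real a + Digamma (of_nat (l + 1)) - of_real (ln x)))
              / (of_real a * fact l)" if "x > 0" for x
        using double1[OF that 7(1)] double2[OF that l] by (simp only: 7(2))
      show "{n. of_real a * of_nat n \<noteq> b - 1 \<and> of_real a * of_nat n \<noteq> b - 1 - \<alpha>} = UNIV - {m, l}"
        using unique[OF 7(1)] unique[OF l] by auto
    qed (simp add: b 7(2) algebra_simps)
  qed
qed

end
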